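(* Let $[X,d,m]$ be a metric random walk space with invariant and reversible probability measure $\nu$, assume $\Theta_m<\infty$ and that $\int_X d(x,x_0)\,d\nu(x)<\infty$ for some $x_0\in X$. Let $K>0$. If $$W_1^d(\mu,\nu)\le\frac1K\sqrt{I_\nu(\mu)}\qquad\text{for all probability measures }\mu\ll\nu,$$ then $$W_1^d(\mu,\nu)\le\sqrt{\frac{\sqrt{2\Theta_m}}{K}\,{\rm Ent}_\nu(\mu)}\qquad\text{for all probability measures }\mu\ll\nu.$$
   Context: A metric random walk space $[X,d,m]$ is a Polish metric space $(X,d)$ with a family $m=(m_x)_{x\in X}$ of Borel probability measures, $x\mapsto m_x(A)$ Borel measurable, each with finite first moment. A Radon measure $\nu$ is invariant if $\nu(A)=\int_X m_x(A)d\nu(x)$ for all $\nu$-measurable $A$, reversible if $dm_x(y)d\nu(x)=dm_y(x)d\nu(y)$. $\Theta_m=\operatorname{ess\,sup}_{x\in X}\frac12\int_X d(x,y)^2dm_x(y)$. $W_1^d$ is the $1$-Wasserstein distance. $\mathcal H_m(f)=\frac12\iint(f(y)-f(x))^2dm_x(y)d\nu(x)$; $I_\nu(\mu)=2\mathcal H_m(\sqrt f)$ if $\mu=f\nu$, $f\ge0$, and $+\infty$ otherwise. Relative entropy: ${\rm Ent}_\nu(\mu)=\int_X f\log f\,d\nu-\nu(f)\log\nu(f)$ if $\mu=f\nu$, $f\ge0$, $f\log f\in L^1(X,\nu)$ (with $0\log0=0$, $\nu(f)=\int f d\nu$), and $+\infty$ otherwise. *)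

theory Defs
  imports "HOL-Analysis.Analysis" "HOL-Probability.Probability"
begin

definition mrw_space :: "('a::polish_space \<Rightarrow> 'a measure) \<Rightarrow> bool" where
  "mrw_space m \<longleftrightarrow>
     (\<forall>x. prob_space (m x) \<and> sets (m x) = sets borel) \<and>
     (\<forall>A\<in>sets borel. (\<lambda>x. emeasure (m x) A) \<in> borel_measurable borel) \<and>
     (\<forall>x. (\<integral>\<^sup>+ y. ennreal (dist x y) \<partial>m x) < \<infinity>)"

definition invariant_measure :: "('a::polish_space \<Rightarrow> 'a measure) \<Rightarrow> 'a measure \<Rightarrow> bool" where
  "invariant_measure m \<nu> \<longleftrightarrow>
     (\<forall>A\<in>sets borel. emeasure \<nu> A = (\<integral>\<^sup>+ x. emeasure (m x) A \<partial>\<nu>))"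

definition reversible_measure :: "('a::polish_space \<Rightarrow> 'a measure) \<Rightarrow> 'a measure \<Rightarrow> bool" where
  "reversible_measure m \<nu> \<longleftrightarrow>
     (\<forall>C\<in>sets (borel \<Otimes>\<^sub>M borel).
        (\<integral>\<^sup>+ x. (\<integral>\<^sup>+ y. indicator C (x, y) \<partial>m x) \<partial>\<nu>) =
        (\<integral>\<^sup>+ y. (\<integral>\<^sup>+ x. indicator C (x, y) \<partial>m y) \<partial>\<nu>))"

definition Theta :: "('a::polish_space \<Rightarrow> 'a measure) \<Rightarrow> 'a measure \<Rightarrow> ennreal" where
  "Theta m \<nu> = esssup \<nu> (\<lambda>x. \<integral>\<^sup>+ y. ennreal ((dist x y)\<^sup>2 / 2) \<partial>m x)"

definition couplings :: "'a::polish_space measure \<Rightarrow> 'a measure \<Rightarrow> ('a \<times> 'a) measure set" where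
  "couplings \<mu> \<rho> = {\<pi>. prob_space \<pi> \<and> sets \<pi> = sets (borel \<Otimes>\<^sub>M borel) \<and>
                         distr \<pi> borel fst = \<mu> \<and> distr \<pi> borel snd = \<rho>}"

definition W1 :: "'a::polish_space measure \<Rightarrow> 'a measure \<Rightarrow> ennreal" where
  "W1 \<mu> \<rho> = (INF \<pi>\<in>couplings \<mu> \<rho>. \<integral>\<^sup>+ p. ennreal (dist (fst p) (snd p)) \<partial>\<pi>)"

definition is_density :: "'a::polish_space measure \<Rightarrow> 'a measure \<Rightarrow> ('a \<Rightarrow> real) \<Rightarrow> bool" where
  "is_density \<nu> \<mu> f \<longleftrightarrow> f \<in> borel_measurable borel \<and> (\<forall>x. 0 \<le> f x) \<and>
                          \<mu> = density \<nu> (\<lambda>x. ennreal (f x))"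

definition H_m :: "('a::polish_space \<Rightarrow> 'a measure) \<Rightarrow> 'a measure \<Rightarrow> ('a \<Rightarrow> real) \<Rightarrow> ennreal" where
  "H_m m \<nu> g = (\<integral>\<^sup>+ x. (\<integral>\<^sup>+ y. ennreal ((g y - g x)\<^sup>2 / 2) \<partial>m x) \<partial>\<nu>)"

text \<open>Fisher information I_nu(mu) = 2 H_m(sqrt f) if mu = f nu, infinity otherwise
  (independent of the choice of the density, by invariance of nu).\<close>
definition Fisher_I :: "('a::polish_space \<Rightarrow> 'a measure) \<Rightarrow> 'a measure \<Rightarrow> 'a measure \<Rightarrow> ennreal" where
  "Fisher_I m \<nu> \<mu> =
     (if \<exists>f. is_density \<nu> \<mu> f
      then 2 * H_m m \<nu> (\<lambda>x. sqrt ((SOME f. is_density \<nu> \<mu> f) x))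
      else \<infinity>)"

definition xlogx :: "real \<Rightarrow> real" where
  "xlogx t = (if t = 0 then 0 else t * ln t)"

definition Ent :: "'a::polish_space measure \<Rightarrow> 'a measure \<Rightarrow> ereal" where
  "Ent \<nu> \<mu> =
     (if \<exists>f. is_density \<nu> \<mu> f \<and> integrable \<nu> (\<lambda>x. xlogx (f x))
      then (let f = (SOME f. is_density \<nu> \<mu> f \<and> integrable \<nu> (\<lambda>x. xlogx (f x)))
            in ereal ((\<integral>x. xlogx (f x) \<partial>\<nu>) - xlogx (\<integral>x. f x \<partial>\<nu>)))
      else \<infinity>)"

end

theory Submission
  imports Defs
begin

text \<open>The argument is that of Bobkov and Goetze. Write \<open>\<Theta>\<close> for \<open>Theta m \<nu>\<close>, let \<open>f\<close> be bounded,
  \<open>1\<close>-Lipschitz and \<open>\<nu>\<close>-centred, and let \<open>Z(l) = \<integral> exp (l f) d\<nu>\<close>. The inequality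
  \<open>(exp a - exp b)\<^sup>2 \<le> (a - b)\<^sup>2 (exp (2 a) + exp (2 b)) / 2\<close> and reversibility bound the Fisher information
  of the tilted measure \<open>exp (l f) \<nu> / Z(l)\<close> by \<open>l\<^sup>2 \<Theta> / 2\<close>. The transport-information inequality for this measure
  thus gives \<open>Z'(l) / Z(l) \<le> c l\<close> with \<open>c = sqrt (\<Theta> / 2) / K\<close>, so that \<open>Z(l) \<le> exp (c l\<^sup>2 / 2)\<close>. By
  the variational formula for the entropy, \<open>l \<integral> f d\<mu> \<le> Ent \<mu> + c l\<^sup>2 / 2\<close> for all \<open>l \<ge> 0\<close>, hence
  \<open>\<integral> f d\<mu> \<le> sqrt (2 c Ent \<mu>)\<close>. Kantorovich-Rubinstein duality turns this into the bound
  on \<open>W1\<close>; the duality is reduced, by quantizing both measures, to linear programming duality on a finite set.\<close>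

section \<open>Kantorovich duality on a finite set\<close>

text \<open>Bartl's induction on the number of constraints: if the constraint \<open>j\<close> cannot be dropped,
  a witness \<open>z\<close> of this has \<open>a j \<bullet> z > 0\<close>, and projecting along \<open>z\<close> onto the kernel of \<open>a j\<close>
  eliminates \<open>j\<close>.\<close>

lemma farkas:
  fixes a :: "'i \<Rightarrow> 'k \<Rightarrow> real" and b :: "'k \<Rightarrow> real"
  assumes "finite I" and K: "finite K"
    and "\<And>x. (\<forall>i\<in>I. (\<Sum>k\<in>K. a i k * x k) \<le> 0) \<Longrightarrow> (\<Sum>k\<in>K. b k * x k) \<le> 0"
  shows "\<exists>l. (\<forall>i\<in>I. 0 \<le> l i) \<and> (\<forall>k\<in>K. b k = (\<Sum>i\<in>I. l i * a i k))"
  using assms(1,3)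
proof (induction I arbitrary: a b rule: finite_induct)
  case empty
  \<comment> \<open>With no constraints left, every \<open>x\<close> is admissible; testing at
    \<open>x = b\<close> forces \<open>b\<close> to vanish on \<open>K\<close>.\<close>
  have "(\<Sum>k\<in>K. b k * b k) \<le> 0"
    using empty by auto
  moreover have "0 \<le> (\<Sum>k\<in>K. b k * b k)"
    by (intro sum_nonneg) auto
  ultimately have "(\<Sum>k\<in>K. b k * b k) = 0" by linarith
  then have "\<forall>k\<in>K. b k = 0"
    using K by (subst (asm) sum_nonneg_eq_0_iff) auto
  then show ?case by auto
next
  case (insert j I)
  define dot where "dot = (\<lambda>u v :: 'k \<Rightarrow> real. \<Sum>k\<in>K. u k * v k)"
  have dot_add: "dot (\<lambda>k. u k - c * u' k) v = dot u v - c * dot u' v"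
    and dot_add': "dot u (\<lambda>k. v k - c * v' k) = dot u v - c * dot u v'" for c u u' v v'
    by (simp_all add: dot_def sum_subtractf sum_distrib_left algebra_simps)
  have dotI: "(\<Sum>k\<in>K. u k * v k) = dot u v" for u v
    by (simp add: dot_def)
  show ?case
  proof (cases "\<forall>x. (\<forall>i\<in>I. dot (a i) x \<le> 0) \<longrightarrow> dot b x \<le> 0")
    case True
    then obtain l where l: "\<forall>i\<in>I. 0 \<le> l i" "\<forall>k\<in>K. b k = (\<Sum>i\<in>I. l i * a i k)"
      using insert.IH[of a b] unfolding dot_def by blast
    have "(\<Sum>i\<in>insert j I. (l(j := 0)) i * a i k) = (\<Sum>i\<in>I. l i * a i k)" for k
      using insert.hyps by (simp, intro sum.cong) auto
    then show ?thesis
      using l by (intro exI[of _ "l(j := 0)"]) (auto simp del: fun_upd_apply, auto)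
  next
    case False
    then obtain z where z: "\<forall>i\<in>I. dot (a i) z \<le> 0" "dot b z > 0" by force
    have jz: "dot (a j) z > 0"
      using insert.prems[of z] z unfolding dotI by force
    \<comment> \<open>\<open>u - r u * a j\<close> annihilates \<open>z\<close>. Passing from
      \<open>a i\<close> to \<open>a' i\<close> is dual to moving \<open>x\<close> along
      \<open>z\<close> into the kernel of \<open>a j\<close>, so
      \<open>dot (a i) x' = dot (a' i) x\<close> for the \<open>x'\<close> below.\<close>
    define r where "r = (\<lambda>u. dot u z / dot (a j) z)"
    define a' where "a' = (\<lambda>i k. a i k - r (a i) * a j k)"
    define b' where "b' = (\<lambda>k. b k - r b * a j k)"
    have "\<exists>l. (\<forall>i\<in>I. 0 \<le> l i) \<and> (\<forall>k\<in>K. b' k = (\<Sum>i\<in>I. l i * a' i k))"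
    proof (rule insert.IH)
      fix x assume "\<forall>i\<in>I. (\<Sum>k\<in>K. a' i k * x k) \<le> 0"
      then have x: "\<forall>i\<in>I. dot (a' i) x \<le> 0" unfolding dot_def by simp
      \<comment> \<open>\<open>x'\<close> meets the constraint \<open>j\<close> with equality, and
        meets the others because \<open>x\<close> meets those of \<open>a'\<close>; the hypothesis
        on \<open>b\<close> therefore applies to it.\<close>
      define x' where "x' = (\<lambda>k. x k - dot (a j) x / dot (a j) z * z k)"
      have "dot (a i) x' = dot (a' i) x" for i
        using jz unfolding x'_def a'_def dot_add dot_add' r_def by (simp add: field_simps)
      moreover have "dot (a j) x' = 0"
        using jz unfolding x'_def dot_add' by simp
      ultimately have "dot b x' \<le> 0"
        using insert.prems[of x'] x unfolding dotI by force
      moreover have "dot b x' = dot b' x"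
        using jz unfolding x'_def b'_def dot_add dot_add' r_def by (simp add: field_simps)
      ultimately show "(\<Sum>k\<in>K. b' k * x k) \<le> 0" unfolding dot_def by simp
    qed
    then obtain l where l: "\<forall>i\<in>I. 0 \<le> l i" "\<forall>k\<in>K. b' k = (\<Sum>i\<in>I. l i * a' i k)" by blast
    \<comment> \<open>The coefficient of \<open>a j\<close> once \<open>a'\<close> and
      \<open>b'\<close> are expanded. It is nonnegative because \<open>r b > 0\<close> and
      \<open>r (a i) \<le> 0\<close> for all \<open>i \<in> I\<close>, by the choice of
      \<open>z\<close>.\<close>
    define lj where "lj = r b - (\<Sum>i\<in>I. l i * r (a i))"
    have "(\<Sum>i\<in>I. l i * r (a i)) \<le> 0"
      using l z jz by (intro sum_nonpos mult_nonneg_nonpos) (auto simp: r_def divide_nonpos_pos)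
    then have "0 \<le> lj"
      using z jz by (auto simp: lj_def r_def intro: order_trans)
    moreover have "b k = (\<Sum>i\<in>insert j I. (l(j := lj)) i * a i k)" if "k \<in> K" for k
    proof -
      have "(\<Sum>i\<in>insert j I. (l(j := lj)) i * a i k) = lj * a j k + (\<Sum>i\<in>I. l i * a i k)"
        using insert.hyps by (simp, intro sum.cong) auto
      moreover have "b k - r b * a j k = (\<Sum>i\<in>I. l i * (a i k - r (a i) * a j k))"
        using l that by (simp add: a'_def b'_def)
      ultimately show ?thesis
        by (simp add: lj_def algebra_simps sum_subtractf sum_distrib_left sum_distrib_right)
    qed
    ultimately show ?thesis
      using l(1) by (intro exI[of _ "l(j := lj)"]) auto
  qed
qed

text \<open>Farkas' lemma is applied in the unknowns \<open>(f, g, c)\<close> with the constraints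
  \<open>f s + g t \<le> c * dist s t\<close> and \<open>c \<ge> 0\<close>. The single potential is
  \<open>h0 z = Min\<^sub>t (c * dist z t - g t)\<close>, which satisfies \<open>f \<le> h0\<close> and \<open>g \<le> - h0\<close> on \<open>S\<close>, is defined
  and \<open>c\<close>-Lipschitz on the whole space, and becomes bounded after truncation.\<close>

lemma finite_kantorovich_duality:
  fixes S :: "'a::metric_space set" and p q :: "'a \<Rightarrow> real"
  assumes S: "finite S" "S \<noteq> {}"
    and p: "\<And>s. 0 \<le> p s" and q: "\<And>s. 0 \<le> q s" and pq: "sum p S = sum q S"
    and dual: "\<And>h. bounded (range h) \<Longrightarrow> 1-lipschitz_on UNIV h \<Longrightarrow>
      (\<Sum>s\<in>S. h s * (p s - q s)) \<le> W"
  shows "\<exists>l. (\<forall>s\<in>S. \<forall>t\<in>S. 0 \<le> l s t) \<and> (\<forall>s\<in>S. p s = (\<Sum>t\<in>S. l s t)) \<and>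
    (\<forall>t\<in>S. q t = (\<Sum>s\<in>S. l s t)) \<and> (\<Sum>s\<in>S. \<Sum>t\<in>S. l s t * dist s t) \<le> W"
proof -
  \<comment> \<open>Rows: \<open>Inl (s, t)\<close> is the constraint on \<open>f s + g t\<close>,
    \<open>Inr ()\<close> the constraint \<open>c \<ge> 0\<close>. Columns: \<open>Inl\<close> holds
    \<open>f\<close>, \<open>Inr (Inl _)\<close> holds \<open>g\<close>, \<open>Inr (Inr ())\<close>
    holds \<open>c\<close>. The multipliers of the rows \<open>Inl (s, t)\<close> will be the
    transport plan.\<close>
  define a where "a = case_sum
    (\<lambda>(s::'a, t::'a). case_sum (\<lambda>u. of_bool (u = s)) (case_sum (\<lambda>u. of_bool (u = t)) (\<lambda>_::unit. - dist s t)))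
    (\<lambda>_::unit. case_sum (\<lambda>_. 0) (case_sum (\<lambda>_. 0) (\<lambda>_. - 1 :: real)))"
  define b where "b = case_sum p (case_sum q (\<lambda>_::unit. - W))"
  have "\<exists>l. (\<forall>i\<in>S \<times> S <+> {()}. 0 \<le> l i) \<and>
    (\<forall>k\<in>S <+> S <+> {()}. b k = (\<Sum>i\<in>S \<times> S <+> {()}. l i * a i k))"
  proof (rule farkas)
    fix x :: "'a + 'a + unit \<Rightarrow> real"
    assume x: "\<forall>i\<in>S \<times> S <+> {()}. (\<Sum>k\<in>S <+> S <+> {()}. a i k * x k) \<le> 0"
    define f where "f s = x (Inl s)" for s
    define g where "g s = x (Inr (Inl s))" for s
    define c where "c = x (Inr (Inr ()))"
    have c: "0 \<le> c"
    proof -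
      have "(\<Sum>k\<in>S <+> S <+> {()}. a (Inr ()) k * x k) \<le> 0"
        using x by blast
      then show ?thesis using S by (simp add: a_def sum.Plus c_def)
    qed
    have fg: "f s + g t \<le> c * dist s t" if "s \<in> S" "t \<in> S" for s t
    proof -
      have "(\<Sum>k\<in>S <+> S <+> {()}. a (Inl (s, t)) k * x k) \<le> 0"
        using x that by blast
      then show ?thesis
        using S that
        by (simp add: a_def sum.Plus f_def g_def c_def of_bool_def if_distrib if_distribR
            sum.delta mult.commute cong: if_cong)
    qed
    define h0 where "h0 z = Min ((\<lambda>t. c * dist z t - g t) ` S)" for z
    \<comment> \<open>Cutting \<open>h0\<close> off from above at its maximum over \<open>S\<close>
      keeps its values on \<open>S\<close>; from below \<open>h0\<close> is already bounded, since
      \<open>c * dist z t \<ge> 0\<close>.\<close>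
    define h where "h z = min (Max (h0 ` S)) (h0 z)" for z
    have h0_le: "h0 z \<le> c * dist z t - g t" if "t \<in> S" for z t
      using S that by (auto simp: h0_def)
    have h0_ge: "u \<le> h0 z" if "\<And>t. t \<in> S \<Longrightarrow> u \<le> c * dist z t - g t" for u z
      using S that by (auto simp: h0_def)
    have h0_lip: "h0 y \<le> h0 z + c * dist y z" for y z
    proof -
      have "h0 y - c * dist y z \<le> c * dist z t - g t" if "t \<in> S" for t
        using h0_le[OF that, of y] mult_left_mono[OF dist_triangle[of y t z] c]
        by (simp add: algebra_simps)
      then show ?thesis using h0_ge[of "h0 y - c * dist y z" z] by simp
    qed
    have h_lip: "\<bar>h y - h z\<bar> \<le> c * dist y z" for y z
      using h0_lip[of y z] h0_lip[of z y] zero_le_mult_iff[of c "dist y z"] c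
      by (auto simp: h_def dist_commute min_def)
    have h_bdd: "bounded (range h)"
    proof -
      have ge: "Min ((\<lambda>t. - g t) ` S) \<le> h0 z" for z
      proof (rule h0_ge)
        fix t assume t: "t \<in> S"
        then have "Min ((\<lambda>t. - g t) ` S) \<le> - g t" using S by auto
        moreover have "0 \<le> c * dist z t" using c by simp
        ultimately show "Min ((\<lambda>t. - g t) ` S) \<le> c * dist z t - g t" by linarith
      qed
      have "range h \<subseteq> {min (Max (h0 ` S)) (Min ((\<lambda>t. - g t) ` S)) .. Max (h0 ` S)}"
        using ge by (fastforce simp: h_def min_le_iff_disj)
      then show ?thesis by (meson bounded_closed_interval bounded_subset)
    qed
    have hS: "h s = h0 s" if "s \<in> S" for s
      using Max_ge[of "h0 ` S" "h0 s"] S that by (simp add: h_def)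
    have "(\<Sum>s\<in>S. h s * (p s - q s)) \<le> c * W"
    \<comment> \<open>For \<open>c > 0\<close> the function \<open>h / c\<close> is an admissible
      potential. For \<open>c = 0\<close> no such scaling exists, but \<open>h\<close> is constant
      and the sum vanishes because \<open>p\<close> and \<open>q\<close> have equal mass.\<close>
    proof (cases "c = 0")
      case True
      obtain s0 where "s0 \<in> S" using S by auto
      then have "(\<Sum>s\<in>S. h s * (p s - q s)) = (\<Sum>s\<in>S. h s0 * (p s - q s))"
        using h_lip True by (intro sum.cong) auto
      also have "\<dots> = 0" using pq by (simp add: sum_distrib_left[symmetric] sum_subtractf)
      finally show ?thesis using True by simp
    next
      case False
      with c have c': "0 < c" by simp
      have "1-lipschitz_on UNIV (\<lambda>z. h z / c)"
        using h_lip c' by (intro lipschitz_onI)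
          (auto simp: dist_real_def diff_divide_distrib[symmetric] divide_le_eq mult.commute)
      moreover have "bounded (range (\<lambda>z. h z / c))"
        using bounded_scaling[OF h_bdd, of "1/c"] by (simp add: image_image)
      ultimately have "(\<Sum>s\<in>S. h s / c * (p s - q s)) \<le> W" by (intro dual)
      then have "(\<Sum>s\<in>S. h s * (p s - q s)) / c \<le> W" by (simp add: sum_divide_distrib)
      then show ?thesis using c' by (simp add: divide_le_eq mult.commute)
    qed
    moreover have "(\<Sum>s\<in>S. p s * f s) + (\<Sum>s\<in>S. q s * g s) \<le> (\<Sum>s\<in>S. h s * (p s - q s))"
    proof -
      have "p s * f s + q s * g s \<le> h s * (p s - q s)" if s: "s \<in> S" for s
      proof -
        have "f s \<le> h s" unfolding hS[OF s]
          using fg[OF s] by (intro h0_ge) (simp add: le_diff_eq)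
        moreover have "g s \<le> - h s" unfolding hS[OF s] using h0_le[OF s, of s] by simp
        ultimately have "p s * f s + q s * g s \<le> p s * h s + q s * (- h s)"
          using p q by (intro add_mono mult_left_mono) auto
        then show ?thesis by (simp add: algebra_simps)
      qed
      then show ?thesis unfolding sum.distrib[symmetric] by (rule sum_mono)
    qed
    moreover have "(\<Sum>k\<in>S <+> S <+> {()}. b k * x k) =
        (\<Sum>s\<in>S. p s * f s) + (\<Sum>s\<in>S. q s * g s) - c * W"
      using S by (simp add: sum.Plus b_def f_def g_def c_def)
    ultimately show "(\<Sum>k\<in>S <+> S <+> {()}. b k * x k) \<le> 0"
      by linarith
  qed (use S in simp_all)
  then obtain l where "(\<forall>i\<in>S \<times> S <+> {()}. 0 \<le> l i) \<and>
    (\<forall>k\<in>S <+> S <+> {()}. b k = (\<Sum>i\<in>S \<times> S <+> {()}. l i * a i k))" ..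
  note l = bspec[OF conjunct1[OF this]] bspec[OF conjunct2[OF this]]
  define l' where "l' s t = l (Inl (s, t))" for s t
  have b: "b k = (\<Sum>s\<in>S. \<Sum>t\<in>S. l' s t * a (Inl (s, t)) k) + l (Inr ()) * a (Inr ()) k"
    if "k \<in> S <+> S <+> {()}" for k
    using l(2)[OF that] S by (simp add: sum.Plus l'_def sum.cartesian_product split_def)
  have "p s = (\<Sum>t\<in>S. l' s t)" if "s \<in> S" for s
  proof -
    have "p s = (\<Sum>u\<in>S. \<Sum>t\<in>S. l' u t * of_bool (s = u))"
      using b[OF InlI[OF that]] by (simp add: b_def a_def)
    also have "\<dots> = (\<Sum>u\<in>S. \<Sum>t\<in>S. if u = s then l' u t else 0)"
      by (intro sum.cong) auto
    also have "\<dots> = (\<Sum>u\<in>S. if u = s then (\<Sum>t\<in>S. l' u t) else 0)"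
      by (intro sum.cong) auto
    finally show ?thesis using that S by simp
  qed
  moreover have "q t = (\<Sum>s\<in>S. l' s t)" if "t \<in> S" for t
    using b[OF InrI[OF InlI[OF that]]] that S
    by (simp add: b_def a_def of_bool_def if_distrib cong: if_cong)
  \<comment> \<open>The last column says that \<open>W\<close> is the cost of \<open>l'\<close> plus
    \<open>l (Inr ())\<close>, and this multiplier is a nonnegative slack.\<close>
  moreover have "(\<Sum>s\<in>S. \<Sum>t\<in>S. l' s t * dist s t) \<le> W"
    using b[OF InrI[OF InrI[of "()" "{()}"]]] l(1)[OF InrI[of "()" "{()}"]] by (simp add: b_def a_def sum_negf)
  moreover have "0 \<le> l' s t" if "s \<in> S" "t \<in> S" for s t
    using l(1)[OF InlI[OF SigmaI[OF that]]] by (simp add: l'_def)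
  ultimately show ?thesis by blast
qed

section \<open>Kantorovich-Rubinstein duality\<close>

text \<open>\<open>g o T\<close> is a finite combination of indicators of the level sets of
  \<open>T\<close>. Measurability rests on \<open>T\<close> alone, so \<open>g\<close> can be any
  function, such as the plan on the finite set.\<close>

lemma nn_integral_finite_range:
  fixes g :: "'b \<Rightarrow> ennreal"
  assumes T: "simple_function M T"
  shows "(\<integral>\<^sup>+x. g (T x) \<partial>M) = (\<Sum>s\<in>T ` space M. g s * emeasure M (T -` {s} \<inter> space M))"
proof -
  have fin: "finite (T ` space M)" and meas: "\<And>s. T -` {s} \<inter> space M \<in> sets M"
    using T by (auto dest: simple_functionD)
  have "(\<integral>\<^sup>+x. g (T x) \<partial>M) =
    (\<integral>\<^sup>+x. (\<Sum>s\<in>T ` space M. g s * indicator (T -` {s} \<inter> space M) x) \<partial>M)"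
    using fin by (intro nn_integral_cong) (simp add: indicator_def if_distrib eq_commute cong: if_cong)
  also have "\<dots> = (\<Sum>s\<in>T ` space M. g s * emeasure M (T -` {s} \<inter> space M))"
    using meas by (simp add: nn_integral_sum nn_integral_cmult_indicator)
  finally show ?thesis .
qed

lemma lipschitz_borel_measurable:
  "L-lipschitz_on UNIV h \<Longrightarrow> h \<in> borel_measurable borel"
  by (intro borel_measurable_continuous_onI lipschitz_on_continuous_on)

text \<open>The coupling \<open>l\<close> of the two images under \<open>T\<close> is lifted to the coupling of \<open>\<mu>\<close> and \<open>\<nu>\<close>
  with density \<open>l (T x) (T y) / (p (T x) * q (T y))\<close>; the junk value at \<open>p s = 0\<close> or \<open>q t = 0\<close>
  only matters on a null set.\<close>

lemma W1_le_quantization: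
  fixes \<mu> \<nu> :: "'a::polish_space measure"
  assumes "prob_space \<mu>" "prob_space \<nu>"
    and sets_eq[measurable_cong]: "sets \<mu> = sets borel" "sets \<nu> = sets borel"
    and T: "simple_function borel T"
    and e1: "(\<integral>\<^sup>+x. ennreal (dist x (T x)) \<partial>\<mu>) < \<infinity>"
    and e2: "(\<integral>\<^sup>+x. ennreal (dist x (T x)) \<partial>\<nu>) < \<infinity>"
    and dual: "\<And>h. bounded (range h) \<Longrightarrow> 1-lipschitz_on UNIV h \<Longrightarrow>
      (\<integral>x. h x \<partial>\<mu>) - (\<integral>x. h x \<partial>\<nu>) \<le> C"
  shows "W1 \<mu> \<nu> \<le> ennreal C +
    2 * ((\<integral>\<^sup>+x. ennreal (dist x (T x)) \<partial>\<mu>) + (\<integral>\<^sup>+x. ennreal (dist x (T x)) \<partial>\<nu>))"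
proof -
  interpret \<mu>: prob_space \<mu> by fact
  interpret \<nu>: prob_space \<nu> by fact
  interpret pair_prob_space \<mu> \<nu> ..
  have space_eq[simp]: "space \<mu> = UNIV" "space \<nu> = UNIV"
    using sets_eq by (auto dest: sets_eq_imp_space_eq)
  have T_meas[measurable]: "T \<in> borel_measurable borel"
    by (rule borel_measurable_simple_function[OF T])
  have T\<mu>: "simple_function \<mu> T" and T\<nu>: "simple_function \<nu> T"
    using T by (simp_all add: simple_function_def sets_eq)
  define S where "S = range T"
  have S: "finite S" "S \<noteq> {}" and TS: "\<And>x. T x \<in> S"
    using simple_functionD(1)[OF T] by (auto simp: S_def)
  define p where "p s = measure \<mu> (T -` {s})" for s
  define q where "q s = measure \<nu> (T -` {s})" for s
  have p: "0 \<le> p s" and q: "0 \<le> q s" for s by (auto simp: p_def q_def)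
  have int\<mu>: "(\<integral>\<^sup>+x. g (T x) \<partial>\<mu>) = (\<Sum>s\<in>S. g s * ennreal (p s))"
    and int\<nu>: "(\<integral>\<^sup>+x. g (T x) \<partial>\<nu>) = (\<Sum>s\<in>S. g s * ennreal (q s))" for g
    using nn_integral_finite_range[OF T\<mu>, of g] nn_integral_finite_range[OF T\<nu>, of g]
    by (simp_all add: S_def p_def q_def \<mu>.emeasure_eq_measure \<nu>.emeasure_eq_measure)
  have int_h: "integrable M h \<and> integrable M (\<lambda>x. h (T x)) \<and>
      (\<integral>x. h (T x) \<partial>M) = (\<Sum>s\<in>S. h s * measure M (T -` {s}))"
    if h: "bounded (range h)" "1-lipschitz_on UNIV h"
      and M: "prob_space M" "sets M = sets borel" for h :: "'a \<Rightarrow> real" and M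
  proof -
    interpret M: prob_space M by fact
    note M(2)[measurable_cong]
    have [measurable]: "h \<in> borel_measurable borel" by (rule lipschitz_borel_measurable[OF h(2)])
    obtain B where B: "\<And>x. \<bar>h x\<bar> \<le> B" using h(1) by (auto simp: bounded_iff)
    have "integrable M h" "integrable M (\<lambda>x. h (T x))"
      using B by (auto intro!: M.integrable_const_bound[where B=B])
    moreover have "(\<integral>x. h (T x) \<partial>M) = (\<integral>x. (\<Sum>s\<in>S. h s * indicator (T -` {s}) x) \<partial>M)"
      using S TS
      by (intro Bochner_Integration.integral_cong) (auto simp: indicator_def if_distrib eq_commute cong: if_cong)
    moreover have "\<dots> = (\<Sum>s\<in>S. h s * measure M (T -` {s}))"
    proof -
      have "T -` {s} \<in> sets M" for s
        using measurable_sets[OF T_meas, of "{s}"] M(2) by simp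
      then show ?thesis
        by (subst Bochner_Integration.integral_sum)
          (auto intro!: sum.cong integrable_real_mult_indicator simp: M.emeasure_eq_measure)
    qed
    ultimately show ?thesis by simp
  qed
  define E1 where "E1 = enn2real (\<integral>\<^sup>+x. ennreal (dist x (T x)) \<partial>\<mu>)"
  define E2 where "E2 = enn2real (\<integral>\<^sup>+x. ennreal (dist x (T x)) \<partial>\<nu>)"
  have E: "(\<integral>\<^sup>+x. ennreal (dist x (T x)) \<partial>\<mu>) = ennreal E1"
    "(\<integral>\<^sup>+x. ennreal (dist x (T x)) \<partial>\<nu>) = ennreal E2"
    using e1 e2 by (simp_all add: E1_def E2_def less_top)
  have E0: "0 \<le> E1" "0 \<le> E2" by (simp_all add: E1_def E2_def)
  have int1: "integrable \<mu> (\<lambda>x. dist x (T x))" "(\<integral>x. dist x (T x) \<partial>\<mu>) = E1"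
    using e1 by (auto intro!: integrableI_nonneg simp: E1_def integral_eq_nn_integral)
  have int2: "integrable \<nu> (\<lambda>x. dist x (T x))" "(\<integral>x. dist x (T x) \<partial>\<nu>) = E2"
    using e2 by (auto intro!: integrableI_nonneg simp: E2_def integral_eq_nn_integral)
  have C0: "0 \<le> C"
    using dual[of "\<lambda>_. 0"] by (simp add: lipschitz_on_def)
  \<comment> \<open>A \<open>1\<close>-Lipschitz \<open>h\<close> changes by at most
    \<open>dist x (T x)\<close> when \<open>x\<close> is replaced by \<open>T x\<close>; so the dual
    bound \<open>C\<close> becomes \<open>C + E1 + E2\<close> for the image measures.\<close>
  have "\<exists>l. (\<forall>s\<in>S. \<forall>t\<in>S. 0 \<le> l s t) \<and> (\<forall>s\<in>S. p s = (\<Sum>t\<in>S. l s t)) \<and>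
    (\<forall>t\<in>S. q t = (\<Sum>s\<in>S. l s t)) \<and> (\<Sum>s\<in>S. \<Sum>t\<in>S. l s t * dist s t) \<le> C + E1 + E2"
  proof (rule finite_kantorovich_duality[OF S p q])
    show "sum p S = sum q S"
      using int_h[of "\<lambda>_. 1" \<mu>] int_h[of "\<lambda>_. 1" \<nu>] sets_eq \<mu>.prob_space_axioms \<nu>.prob_space_axioms
      by (simp add: lipschitz_on_def p_def q_def \<mu>.prob_space[simplified] \<nu>.prob_space[simplified])
    fix h :: "'a \<Rightarrow> real" assume h: "bounded (range h)" "1-lipschitz_on UNIV h"
    have hT: "\<bar>h (T x) - h x\<bar> \<le> dist x (T x)" for x
      using lipschitz_onD[OF h(2), of "T x" x] by (simp add: dist_real_def dist_commute)
    note I = int_h[OF h \<mu>.prob_space_axioms sets_eq(1)] int_h[OF h \<nu>.prob_space_axioms sets_eq(2)]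
    have "(\<integral>x. h (T x) \<partial>\<mu>) \<le> (\<integral>x. h x + dist x (T x) \<partial>\<mu>)"
      using I int1 hT by (intro integral_mono) (auto simp: abs_le_iff algebra_simps)
    moreover have "(\<integral>x. h x - dist x (T x) \<partial>\<nu>) \<le> (\<integral>x. h (T x) \<partial>\<nu>)"
      using I int2 hT by (intro integral_mono) (auto simp: abs_le_iff algebra_simps)
    ultimately show "(\<Sum>s\<in>S. h s * (p s - q s)) \<le> C + E1 + E2"
      using I int1 int2 dual[OF h] by (simp add: p_def q_def algebra_simps sum_subtractf)
  qed
  then obtain l where l0: "\<And>s t. s \<in> S \<Longrightarrow> t \<in> S \<Longrightarrow> 0 \<le> l s t"
    and lp: "\<And>s. s \<in> S \<Longrightarrow> p s = (\<Sum>t\<in>S. l s t)"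
    and lq: "\<And>t. t \<in> S \<Longrightarrow> q t = (\<Sum>s\<in>S. l s t)"
    and lW: "(\<Sum>s\<in>S. \<Sum>t\<in>S. l s t * dist s t) \<le> C + E1 + E2" by blast
  \<comment> \<open>Nonnegative entries with a vanishing row or column sum vanish. Thus
    \<open>w s t * p s * q t = l s t\<close> on all of \<open>S \<times> S\<close>, also where
    \<open>w\<close> divides by zero.\<close>
  have l_zero: "l s t = 0" if "s \<in> S" "t \<in> S" "p s = 0 \<or> q t = 0" for s t
    using that lp[of s] lq[of t] l0 S sum_nonneg_eq_0_iff[of S "l s"] sum_nonneg_eq_0_iff[of S "\<lambda>s. l s t"]
    by auto
  define w where "w s t = l s t / (p s * q t)" for s t
  have w0: "0 \<le> w s t" if "s \<in> S" "t \<in> S" for s t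
    using l0[OF that] p q by (simp add: w_def)
  define W where "W = (\<lambda>z. ennreal (w (T (fst z)) (T (snd z))))"
  have W_meas[measurable]: "W \<in> borel_measurable (borel \<Otimes>\<^sub>M borel)"
  proof -
    have "W = (\<lambda>z. \<Sum>s\<in>S. \<Sum>t\<in>S. ennreal (w s t) * (indicator {s} (T (fst z)) * indicator {t} (T (snd z))))"
    proof
      fix z
      have "(\<Sum>s\<in>S. \<Sum>t\<in>S. ennreal (w s t) * (indicator {s} (T (fst z)) * indicator {t} (T (snd z)))) =
        (\<Sum>s\<in>S. \<Sum>t\<in>S. if t = T (snd z) then (if s = T (fst z) then ennreal (w s t) else 0) else 0)"
        by (intro sum.cong) (auto simp: indicator_def)
      then show "W z = (\<Sum>s\<in>S. \<Sum>t\<in>S. ennreal (w s t) * (indicator {s} (T (fst z)) * indicator {t} (T (snd z))))"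
        using S TS by (simp add: W_def)
    qed
    then show ?thesis by simp
  qed
  define \<pi> where "\<pi> = density (\<mu> \<Otimes>\<^sub>M \<nu>) W"
  have sets_\<pi>[measurable_cong]: "sets \<pi> = sets (borel \<Otimes>\<^sub>M borel)"
    by (simp add: \<pi>_def sets_eq cong: sets_pair_measure_cong)
  \<comment> \<open>The row sums of \<open>l\<close> are \<open>p\<close>, so the row of
    \<open>T x\<close> contributes \<open>p (T x) / p (T x)\<close>. Integrating \<open>y\<close>
    out of \<open>W\<close> therefore leaves the density \<open>1\<close>, which makes
    \<open>\<mu>\<close> the first marginal; \<open>w_sum2\<close> does the same for
    \<open>\<nu>\<close>.\<close>
  have w_sum1: "(\<integral>\<^sup>+y. W (x, y) \<partial>\<nu>) = 1" if "p (T x) \<noteq> 0" for x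
  proof -
    have "(\<integral>\<^sup>+y. W (x, y) \<partial>\<nu>) = (\<Sum>t\<in>S. ennreal (w (T x) t) * ennreal (q t))"
      using int\<nu>[of "\<lambda>t. ennreal (w (T x) t)"] by (simp add: W_def)
    also have "\<dots> = ennreal (\<Sum>t\<in>S. w (T x) t * q t)"
      using w0 TS q by (simp add: sum_ennreal flip: ennreal_mult)
    also have "(\<Sum>t\<in>S. w (T x) t * q t) = (\<Sum>t\<in>S. l (T x) t / p (T x))"
      using l_zero[OF TS] by (intro sum.cong) (auto simp: w_def)
    also have "\<dots> = 1"
      using lp[OF TS, of x] that by (simp add: sum_divide_distrib[symmetric])
    finally show ?thesis by simp
  qed
  have w_sum2: "(\<integral>\<^sup>+x. W (x, y) \<partial>\<mu>) = 1" if "q (T y) \<noteq> 0" for y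
  proof -
    have "(\<integral>\<^sup>+x. W (x, y) \<partial>\<mu>) = (\<Sum>s\<in>S. ennreal (w s (T y)) * ennreal (p s))"
      using int\<mu>[of "\<lambda>s. ennreal (w s (T y))"] by (simp add: W_def)
    also have "\<dots> = ennreal (\<Sum>s\<in>S. w s (T y) * p s)"
      using w0 TS p by (simp add: sum_ennreal flip: ennreal_mult)
    also have "(\<Sum>s\<in>S. w s (T y) * p s) = (\<Sum>s\<in>S. l s (T y) / q (T y))"
      using l_zero[OF _ TS] by (intro sum.cong) (auto simp: w_def)
    also have "\<dots> = 1"
      using lq[OF TS, of y] that by (simp add: sum_divide_distrib[symmetric])
    finally show ?thesis by simp
  qed
  have AE_p: "AE x in \<mu>. p (T x) \<noteq> 0" and AE_q: "AE x in \<nu>. q (T x) \<noteq> 0"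
  proof -
    have "(\<integral>\<^sup>+x. of_bool (p (T x) = 0) \<partial>\<mu>) = 0" "(\<integral>\<^sup>+x. of_bool (q (T x) = 0) \<partial>\<nu>) = 0"
      using int\<mu>[of "\<lambda>s. of_bool (p s = 0)"] int\<nu>[of "\<lambda>s. of_bool (q s = 0)"] S by auto
    moreover have "simple_function \<mu> (\<lambda>x. of_bool (p (T x) = 0) :: ennreal)"
      "simple_function \<nu> (\<lambda>x. of_bool (q (T x) = 0) :: ennreal)"
      using simple_function_compose[OF T\<mu>, of "\<lambda>s. of_bool (p s = 0) :: ennreal"]
        simple_function_compose[OF T\<nu>, of "\<lambda>s. of_bool (q s = 0) :: ennreal"]
      by (simp_all add: comp_def)
    ultimately show "AE x in \<mu>. p (T x) \<noteq> 0" "AE x in \<nu>. q (T x) \<noteq> 0"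
      by (simp_all add: nn_integral_0_iff_AE borel_measurable_simple_function)
  qed
  have int_\<pi>: "(\<integral>\<^sup>+z. g z \<partial>\<pi>) = (\<integral>\<^sup>+z. W z * g z \<partial>(\<mu> \<Otimes>\<^sub>M \<nu>))"
    if [measurable]: "g \<in> borel_measurable (borel \<Otimes>\<^sub>M borel)" for g
    unfolding \<pi>_def by (subst nn_integral_density) auto
  have fst_\<pi>: "(\<integral>\<^sup>+z. g (fst z) \<partial>\<pi>) = (\<integral>\<^sup>+x. g x \<partial>\<mu>)"
    if [measurable]: "g \<in> borel_measurable borel" for g
  proof -
    have "(\<integral>\<^sup>+z. g (fst z) \<partial>\<pi>) = (\<integral>\<^sup>+x. \<integral>\<^sup>+y. W (x, y) * g x \<partial>\<nu> \<partial>\<mu>)"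
      by (subst int_\<pi>, simp, subst \<nu>.nn_integral_fst[symmetric]) auto
    also have "\<dots> = (\<integral>\<^sup>+x. (\<integral>\<^sup>+y. W (x, y) \<partial>\<nu>) * g x \<partial>\<mu>)"
      by (intro nn_integral_cong nn_integral_multc) measurable
    also have "\<dots> = (\<integral>\<^sup>+x. g x \<partial>\<mu>)"
      using AE_p by (intro nn_integral_cong_AE) (auto simp: w_sum1)
    finally show ?thesis .
  qed
  have snd_\<pi>: "(\<integral>\<^sup>+z. g (snd z) \<partial>\<pi>) = (\<integral>\<^sup>+y. g y \<partial>\<nu>)"
    if [measurable]: "g \<in> borel_measurable borel" for g
  proof -
    have "(\<integral>\<^sup>+z. g (snd z) \<partial>\<pi>) = (\<integral>\<^sup>+y. \<integral>\<^sup>+x. W (x, y) * g y \<partial>\<mu> \<partial>\<nu>)"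
      by (subst int_\<pi>, simp, subst nn_integral_snd[symmetric]) auto
    also have "\<dots> = (\<integral>\<^sup>+y. (\<integral>\<^sup>+x. W (x, y) \<partial>\<mu>) * g y \<partial>\<nu>)"
      by (intro nn_integral_cong nn_integral_multc) measurable
    also have "\<dots> = (\<integral>\<^sup>+y. g y \<partial>\<nu>)"
      using AE_q by (intro nn_integral_cong_AE) (auto simp: w_sum2)
    finally show ?thesis .
  qed
  have "\<pi> \<in> couplings \<mu> \<nu>"
    unfolding couplings_def
  proof (intro CollectI conjI sets_\<pi>)
    show "prob_space \<pi>"
      using fst_\<pi>[of "\<lambda>_. 1"] \<mu>.emeasure_space_1 by (intro prob_spaceI) simp
    show "distr \<pi> borel fst = \<mu>"
    proof (rule measure_eqI)
      fix A assume "A \<in> sets (distr \<pi> borel fst)"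
      then have [measurable]: "A \<in> sets borel" by simp
      have "emeasure (distr \<pi> borel fst) A = (\<integral>\<^sup>+x. indicator A x \<partial>distr \<pi> borel fst)" by simp
      also have "\<dots> = (\<integral>\<^sup>+z. indicator A (fst z) \<partial>\<pi>)" by (intro nn_integral_distr) measurable
      also have "\<dots> = emeasure \<mu> A" by (simp add: fst_\<pi> sets_eq)
      finally show "emeasure (distr \<pi> borel fst) A = emeasure \<mu> A" .
    qed (simp add: sets_eq)
    show "distr \<pi> borel snd = \<nu>"
    proof (rule measure_eqI)
      fix A assume "A \<in> sets (distr \<pi> borel snd)"
      then have [measurable]: "A \<in> sets borel" by simp
      have "emeasure (distr \<pi> borel snd) A = (\<integral>\<^sup>+x. indicator A x \<partial>distr \<pi> borel snd)" by simp
      also have "\<dots> = (\<integral>\<^sup>+z. indicator A (snd z) \<partial>\<pi>)" by (intro nn_integral_distr) measurable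
      also have "\<dots> = emeasure \<nu> A" by (simp add: snd_\<pi> sets_eq)
      finally show "emeasure (distr \<pi> borel snd) A = emeasure \<nu> A" .
    qed (simp add: sets_eq)
  qed
  then have "W1 \<mu> \<nu> \<le> (\<integral>\<^sup>+z. ennreal (dist (fst z) (snd z)) \<partial>\<pi>)"
    unfolding W1_def by (rule INF_lower)
  \<comment> \<open>The route from \<open>fst z\<close> to \<open>snd z\<close> passes through their
    images under \<open>T\<close>. The outer legs cost \<open>E1 + E2\<close> and the middle one at
    most \<open>C + E1 + E2\<close>, whence the factor \<open>2\<close>.\<close>
  also have "\<dots> \<le> (\<integral>\<^sup>+z. ennreal (dist (fst z) (T (fst z))) + ennreal (dist (T (fst z)) (T (snd z)))
      + ennreal (dist (snd z) (T (snd z))) \<partial>\<pi>)"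
  proof (rule nn_integral_mono)
    fix z
    have "dist (fst z) (snd z) \<le> dist (fst z) (T (fst z)) + dist (T (fst z)) (T (snd z)) + dist (snd z) (T (snd z))"
      using dist_triangle[of "fst z" "snd z" "T (fst z)"] dist_triangle[of "T (fst z)" "snd z" "T (snd z)"]
      by (simp add: dist_commute)
    then show "ennreal (dist (fst z) (snd z)) \<le> ennreal (dist (fst z) (T (fst z))) +
      ennreal (dist (T (fst z)) (T (snd z))) + ennreal (dist (snd z) (T (snd z)))"
      by (simp flip: ennreal_plus)
  qed
  also have "\<dots> = ennreal E1 + (\<integral>\<^sup>+z. ennreal (dist (T (fst z)) (T (snd z))) \<partial>\<pi>) + ennreal E2"
    using fst_\<pi>[of "\<lambda>x. ennreal (dist x (T x))"] snd_\<pi>[of "\<lambda>x. ennreal (dist x (T x))"]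
    by (simp add: nn_integral_add E)
  also have "(\<integral>\<^sup>+z. ennreal (dist (T (fst z)) (T (snd z))) \<partial>\<pi>) =
      ennreal (\<Sum>s\<in>S. \<Sum>t\<in>S. l s t * dist s t)"
  proof -
    have "(\<integral>\<^sup>+z. ennreal (dist (T (fst z)) (T (snd z))) \<partial>\<pi>) =
      (\<integral>\<^sup>+x. \<integral>\<^sup>+y. W (x, y) * ennreal (dist (T x) (T y)) \<partial>\<nu> \<partial>\<mu>)"
      by (subst int_\<pi>, simp, subst \<nu>.nn_integral_fst[symmetric]) auto
    also have "\<dots> = (\<Sum>s\<in>S. (\<Sum>t\<in>S. ennreal (w s t) * ennreal (dist s t) * ennreal (q t)) * ennreal (p s))"
    proof -
      have "(\<integral>\<^sup>+y. W (x, y) * ennreal (dist (T x) (T y)) \<partial>\<nu>) =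
          (\<Sum>t\<in>S. ennreal (w (T x) t) * ennreal (dist (T x) t) * ennreal (q t))" for x
        unfolding W_def fst_conv snd_conv
        by (rule int\<nu>[of "\<lambda>t. ennreal (w (T x) t) * ennreal (dist (T x) t)"])
      then show ?thesis
        by (simp only: int\<mu>[of "\<lambda>s. \<Sum>t\<in>S. ennreal (w s t) * ennreal (dist s t) * ennreal (q t)"])
    qed
    also have "\<dots> = ennreal (\<Sum>s\<in>S. (\<Sum>t\<in>S. w s t * dist s t * q t) * p s)"
      using w0 p q by (simp add: sum_ennreal sum_nonneg flip: ennreal_mult)
    also have "(\<Sum>s\<in>S. (\<Sum>t\<in>S. w s t * dist s t * q t) * p s) = (\<Sum>s\<in>S. \<Sum>t\<in>S. l s t * dist s t)"
      using l_zero by (auto simp: sum_distrib_right w_def intro!: sum.cong)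
    finally show ?thesis .
  qed
  also have "ennreal E1 + ennreal (\<Sum>s\<in>S. \<Sum>t\<in>S. l s t * dist s t) + ennreal E2 \<le>
      ennreal E1 + ennreal (C + E1 + E2) + ennreal E2"
    using lW by (intro add_mono ennreal_leI) auto
  also have "\<dots> = ennreal C + 2 * (ennreal E1 + ennreal E2)"
  proof -
    have "2 * (ennreal E1 + ennreal E2) = ennreal (2 * (E1 + E2))"
      using E0 by (simp add: ennreal_mult)
    then show ?thesis
      using C0 E0 by (simp flip: ennreal_plus)
  qed
  finally show ?thesis by (simp add: E)
qed

section \<open>Removing the quantization error\<close>

text \<open>The truncations \<open>min (dist x x0) n\<close> are bounded and
  \<open>1\<close>-Lipschitz, so the dual bound controls their \<open>\<mu>\<close>-integrals
  uniformly in \<open>n\<close>; monotone convergence concludes. This moment makes the quantization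
  errors of \<open>\<mu>\<close> finite and lets them tend to zero.\<close>

lemma finite_first_moment_transfer:
  fixes \<mu> \<nu> :: "'a::polish_space measure"
  assumes "prob_space \<mu>" "prob_space \<nu>"
    and sets_eq[measurable_cong]: "sets \<mu> = sets borel" "sets \<nu> = sets borel"
    and moment: "(\<integral>\<^sup>+x. ennreal (dist x x0) \<partial>\<nu>) < \<infinity>"
    and dual: "\<And>h :: 'a \<Rightarrow> real. bounded (range h) \<Longrightarrow> 1-lipschitz_on UNIV h \<Longrightarrow>
      (\<integral>x. h x \<partial>\<mu>) - (\<integral>x. h x \<partial>\<nu>) \<le> C"
  shows "(\<integral>\<^sup>+x. ennreal (dist x x0) \<partial>\<mu>) < \<infinity>"
proof -
  interpret \<mu>: prob_space \<mu> by fact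
  interpret \<nu>: prob_space \<nu> by fact
  define h where "h n x = min (dist x x0) (real n)" for n x
  have [measurable]: "h n \<in> borel_measurable borel" for n unfolding h_def by measurable
  have h: "0 \<le> h n x" "h n x \<le> real n" "h n x \<le> dist x x0" for n x by (auto simp: h_def)
  have C0: "0 \<le> C" using dual[of "\<lambda>_. 0"] by (simp add: lipschitz_on_def)
  have bound: "(\<integral>\<^sup>+x. ennreal (h n x) \<partial>\<mu>) \<le> ennreal C + (\<integral>\<^sup>+x. ennreal (dist x x0) \<partial>\<nu>)" for n
  proof -
    have "bounded (range (h n))"
      unfolding bounded_iff using h by (intro exI[of _ "real n"]) auto
    moreover have "1-lipschitz_on UNIV (h n)"
    proof (intro lipschitz_onI)
      fix x y
      show "dist (h n x) (h n y) \<le> 1 * dist x y"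
        using dist_triangle[of x x0 y] dist_triangle[of y x0 x]
        by (auto simp: h_def dist_real_def dist_commute min_def)
    qed simp
    ultimately have "(\<integral>x. h n x \<partial>\<mu>) \<le> C + (\<integral>x. h n x \<partial>\<nu>)"
      using dual[of "h n"] by simp
    moreover have "integrable \<mu> (h n)" "integrable \<nu> (h n)"
      using h by (auto intro!: \<mu>.integrable_const_bound[where B="real n"]
          \<nu>.integrable_const_bound[where B="real n"])
    ultimately have "(\<integral>\<^sup>+x. ennreal (h n x) \<partial>\<mu>) \<le> ennreal C + (\<integral>\<^sup>+x. ennreal (h n x) \<partial>\<nu>)"
      using h C0 by (simp add: nn_integral_eq_integral flip: ennreal_plus)
    also have "(\<integral>\<^sup>+x. ennreal (h n x) \<partial>\<nu>) \<le> (\<integral>\<^sup>+x. ennreal (dist x x0) \<partial>\<nu>)"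
      using h by (intro nn_integral_mono ennreal_leI) auto
    finally show ?thesis by (simp add: add_left_mono)
  qed
  have "(\<lambda>n. \<integral>\<^sup>+x. ennreal (h n x) \<partial>\<mu>) \<longlonglongrightarrow> (\<integral>\<^sup>+x. ennreal (dist x x0) \<partial>\<mu>)"
  proof (rule nn_integral_LIMSEQ)
    show "incseq (\<lambda>n x. ennreal (h n x))"
      by (auto simp: incseq_def le_fun_def h_def intro!: ennreal_leI)
    show "(\<lambda>n. ennreal (h n x)) \<longlonglongrightarrow> ennreal (dist x x0)" for x
    proof (rule tendsto_eventually)
      obtain N where "dist x x0 \<le> real N" using real_arch_simple by blast
      then show "\<forall>\<^sub>F n in sequentially. ennreal (h n x) = ennreal (dist x x0)"
        by (intro eventually_sequentiallyI[of N]) (auto simp: h_def min_def)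
    qed
  qed simp
  then have "(\<integral>\<^sup>+x. ennreal (dist x x0) \<partial>\<mu>) \<le> ennreal C + (\<integral>\<^sup>+x. ennreal (dist x x0) \<partial>\<nu>)"
    using bound by (intro LIMSEQ_le_const2) auto
  also have "\<dots> < \<infinity>" using moment by simp
  finally show ?thesis .
qed

text \<open>The hard direction of Kantorovich-Rubinstein duality. The identity is a pointwise limit
  of simple functions \<open>F i\<close> with \<open>dist (F i x) x0 \<le> 2 * dist x x0\<close>, so
  the errors \<open>dist x (F i x)\<close> are dominated by the integrable
  \<open>3 * dist x x0\<close> and vanish in the limit.\<close>

lemma W1_le_dual:
  fixes \<mu> \<nu> :: "'a::polish_space measure"
  assumes \<mu>: "prob_space \<mu>" and \<nu>: "prob_space \<nu>"
    and sets_eq[measurable_cong]: "sets \<mu> = sets borel" "sets \<nu> = sets borel"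
    and moment: "(\<integral>\<^sup>+x. ennreal (dist x x0) \<partial>\<nu>) < \<infinity>"
    and dual: "\<And>h :: 'a \<Rightarrow> real. bounded (range h) \<Longrightarrow> 1-lipschitz_on UNIV h \<Longrightarrow>
      (\<integral>x. h x \<partial>\<mu>) - (\<integral>x. h x \<partial>\<nu>) \<le> C"
  shows "W1 \<mu> \<nu> \<le> ennreal C"
proof -
  have moment': "(\<integral>\<^sup>+x. ennreal (dist x x0) \<partial>\<mu>) < \<infinity>"
    by (rule finite_first_moment_transfer[OF \<mu> \<nu> sets_eq moment dual])
  obtain F :: "nat \<Rightarrow> 'a \<Rightarrow> 'a" where F: "\<And>i. simple_function borel (F i)"
    "\<And>x. (\<lambda>i. F i x) \<longlonglongrightarrow> x" "\<And>i x. dist (F i x) x0 \<le> 2 * dist x x0"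
    using borel_measurable_implies_sequence_metric[of "\<lambda>x. x" borel x0] by auto
  note [measurable] = borel_measurable_simple_function[OF F(1)]
  have F_dist: "dist x (F i x) \<le> 3 * dist x x0" for i x
    using dist_triangle[of x "F i x" x0] F(3)[of i x] by (simp add: dist_commute)
  define e where "e M i = (\<integral>\<^sup>+x. ennreal (dist x (F i x)) \<partial>M)" for M i
  have e: "e M \<longlonglongrightarrow> 0 \<and> (\<forall>i. e M i < \<infinity>)"
    if [measurable_cong]: "sets M = sets borel" and fin: "(\<integral>\<^sup>+x. ennreal (dist x x0) \<partial>M) < \<infinity>" for M
  proof -
    have fin3: "(\<integral>\<^sup>+x. ennreal (3 * dist x x0) \<partial>M) < \<infinity>"
      using fin by (simp add: ennreal_mult nn_integral_cmult ennreal_mult_less_top)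
    have "e M \<longlonglongrightarrow> (\<integral>\<^sup>+x. 0 \<partial>M)"
      unfolding e_def
    proof (rule nn_integral_dominated_convergence[where w="\<lambda>x. ennreal (3 * dist x x0)"])
      show "AE x in M. (\<lambda>i. ennreal (dist x (F i x))) \<longlonglongrightarrow> 0"
      proof (rule AE_I2)
        fix x
        have "(\<lambda>i. dist x (F i x)) \<longlonglongrightarrow> dist x x"
          by (intro tendsto_dist tendsto_const F(2))
        then show "(\<lambda>i. ennreal (dist x (F i x))) \<longlonglongrightarrow> 0"
          using tendsto_ennrealI by fastforce
      qed
    qed (use fin3 F_dist in \<open>auto intro!: ennreal_leI\<close>)
    moreover have "e M i \<le> (\<integral>\<^sup>+x. ennreal (3 * dist x x0) \<partial>M)" for i
      unfolding e_def using F_dist by (intro nn_integral_mono ennreal_leI)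
    ultimately show ?thesis using fin3 by (auto intro: le_less_trans)
  qed
  have "(\<lambda>i. ennreal C + 2 * (e \<mu> i + e \<nu> i)) \<longlonglongrightarrow> ennreal C + 2 * (0 + 0)"
    using e[OF sets_eq(1) moment'] e[OF sets_eq(2) moment]
    by (intro tendsto_add tendsto_const ennreal_tendsto_cmult) auto
  moreover have "W1 \<mu> \<nu> \<le> ennreal C + 2 * (e \<mu> i + e \<nu> i)" for i
    using e[OF sets_eq(1) moment'] e[OF sets_eq(2) moment] unfolding e_def
    by (intro W1_le_quantization[OF \<mu> \<nu> sets_eq F(1) _ _ dual]) auto
  ultimately show ?thesis
    by (intro LIMSEQ_le_const) auto
qed

text \<open>The easy direction: a coupling puts both integrals on one space, where the Lipschitz
  bound holds pointwise. A negative difference becomes \<open>0\<close> under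
  \<open>ennreal\<close>.\<close>

lemma lipschitz_integral_diff_le_W1:
  fixes \<mu> \<nu> :: "'a::polish_space measure"
  assumes f: "bounded (range f)" "1-lipschitz_on UNIV f"
  shows "ennreal ((\<integral>x. f x \<partial>\<mu>) - (\<integral>x. f x \<partial>\<nu>)) \<le> W1 \<mu> \<nu>"
  unfolding W1_def
proof (rule INF_greatest)
  fix \<pi> assume "\<pi> \<in> couplings \<mu> \<nu>"
  then have "prob_space \<pi>" and [measurable_cong]: "sets \<pi> = sets (borel \<Otimes>\<^sub>M borel)"
    and \<mu>: "\<mu> = distr \<pi> borel fst" and \<nu>: "\<nu> = distr \<pi> borel snd"
    by (auto simp: couplings_def)
  interpret \<pi>: prob_space \<pi> by fact
  have [measurable]: "f \<in> borel_measurable borel" by (rule lipschitz_borel_measurable[OF f(2)])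
  obtain B where B: "\<And>x. \<bar>f x\<bar> \<le> B" using f(1) by (auto simp: bounded_iff)
  have int: "integrable \<pi> (\<lambda>z. f (fst z))" "integrable \<pi> (\<lambda>z. f (snd z))"
    using B by (auto intro!: \<pi>.integrable_const_bound[where B=B])
  show "ennreal ((\<integral>x. f x \<partial>\<mu>) - (\<integral>x. f x \<partial>\<nu>)) \<le> (\<integral>\<^sup>+z. ennreal (dist (fst z) (snd z)) \<partial>\<pi>)"
  proof (cases "(\<integral>\<^sup>+z. ennreal (dist (fst z) (snd z)) \<partial>\<pi>) = \<infinity>")
    case False
    then have d: "integrable \<pi> (\<lambda>z. dist (fst z) (snd z))"
      by (intro integrableI_nonneg) (auto simp: less_top)
    have "(\<integral>x. f x \<partial>\<mu>) - (\<integral>x. f x \<partial>\<nu>) = (\<integral>z. f (fst z) - f (snd z) \<partial>\<pi>)"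
      unfolding \<mu> \<nu> using int by (simp add: integral_distr)
    also have "\<dots> \<le> (\<integral>z. dist (fst z) (snd z) \<partial>\<pi>)"
    proof (intro integral_mono d Bochner_Integration.integrable_diff int)
      show "f (fst z) - f (snd z) \<le> dist (fst z) (snd z)" for z
        using lipschitz_onD[OF f(2), of "fst z" "snd z"] by (simp add: dist_real_def)
    qed
    finally show ?thesis
      using d by (simp add: nn_integral_eq_integral ennreal_leI)
  qed simp
qed

section \<open>Fisher information of tilted measures\<close>

text \<open>Views the random walk as a kernel of the Giry monad, which gives access to
  \<open>bind\<close> and to the measurability of iterated integrals.\<close>

lemma mrw_space_measurable:
  "mrw_space m \<Longrightarrow> m \<in> borel \<rightarrow>\<^sub>M subprob_algebra borel"
  by (intro measurable_subprob_algebra) (auto simp: mrw_space_def prob_space_imp_subprob_space)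

text \<open>Reversibility on sets says that the law of (start, end) of one step from
  \<open>\<nu>\<close> is symmetric. Both laws are realised as \<open>\<nu> \<bind> K1\<close> and
  \<open>\<nu> \<bind> K2\<close>; being equal measures, they integrate every \<open>g\<close>
  alike.\<close>

lemma reversible_measure_nn_integral:
  fixes m :: "'a::polish_space \<Rightarrow> 'a measure"
  assumes m: "mrw_space m" and \<nu>[measurable_cong]: "sets \<nu> = sets borel" and rev: "reversible_measure m \<nu>"
    and g[measurable]: "g \<in> borel_measurable (borel \<Otimes>\<^sub>M borel)"
  shows "(\<integral>\<^sup>+x. \<integral>\<^sup>+y. g (x, y) \<partial>m x \<partial>\<nu>) = (\<integral>\<^sup>+x. \<integral>\<^sup>+y. g (y, x) \<partial>m x \<partial>\<nu>)"
proof -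
  note mm[measurable] = mrw_space_measurable[OF m]
  have m_sets[measurable_cong]: "sets (m x) = sets borel" for x using m by (simp add: mrw_space_def)
  have space_\<nu>: "space \<nu> \<noteq> {}" using sets_eq_imp_space_eq[OF \<nu>] by simp
  define K1 where "K1 x = distr (m x) (borel \<Otimes>\<^sub>M borel) (\<lambda>y. (x, y))" for x
  define K2 where "K2 x = distr (m x) (borel \<Otimes>\<^sub>M borel) (\<lambda>y. (y, x))" for x
  have K[measurable]: "K1 \<in> \<nu> \<rightarrow>\<^sub>M subprob_algebra (borel \<Otimes>\<^sub>M borel)"
    "K2 \<in> \<nu> \<rightarrow>\<^sub>M subprob_algebra (borel \<Otimes>\<^sub>M borel)"
    unfolding K1_def K2_def
    by (rule measurable_distr2[where M=borel]; measurable)+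
  have int1: "(\<integral>\<^sup>+z. g z \<partial>(\<nu> \<bind> K1)) = (\<integral>\<^sup>+x. \<integral>\<^sup>+y. g (x, y) \<partial>m x \<partial>\<nu>)"
    and int2: "(\<integral>\<^sup>+z. g z \<partial>(\<nu> \<bind> K2)) = (\<integral>\<^sup>+x. \<integral>\<^sup>+y. g (y, x) \<partial>m x \<partial>\<nu>)"
    if [measurable]: "g \<in> borel_measurable (borel \<Otimes>\<^sub>M borel)" for g
    by (simp_all add: nn_integral_bind[OF that K(1)] nn_integral_bind[OF that K(2)] K1_def K2_def
        nn_integral_distr)
  have sets_K: "sets (\<nu> \<bind> K1) = sets (borel \<Otimes>\<^sub>M borel)" "sets (\<nu> \<bind> K2) = sets (borel \<Otimes>\<^sub>M borel)"
    using space_\<nu> by (auto intro!: sets_bind simp: K1_def K2_def)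
  have "\<nu> \<bind> K1 = \<nu> \<bind> K2"
  proof (rule measure_eqI)
    fix C assume "C \<in> sets (\<nu> \<bind> K1)"
    then have C[measurable]: "C \<in> sets (borel \<Otimes>\<^sub>M borel)" by (simp add: sets_K)
    have "emeasure (\<nu> \<bind> K1) C = (\<integral>\<^sup>+z. indicator C z \<partial>(\<nu> \<bind> K1))" by (simp add: sets_K)
    also have "\<dots> = (\<integral>\<^sup>+z. indicator C z \<partial>(\<nu> \<bind> K2))"
      using rev C by (simp add: int1 int2 reversible_measure_def del: nn_integral_indicator)
    finally show "emeasure (\<nu> \<bind> K1) C = emeasure (\<nu> \<bind> K2) C" by (simp add: sets_K)
  qed (simp add: sets_K)
  then show ?thesis using int1[OF g] int2[OF g] by simp
qed

text \<open>A null set \<open>N\<close> covers the exceptional points, and invariance turns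
  \<open>\<nu> N = 0\<close> into a vanishing integral of \<open>m x N\<close> over
  \<open>x\<close>.\<close>

lemma invariant_measure_AE:
  fixes m :: "'a::polish_space \<Rightarrow> 'a measure"
  assumes m: "mrw_space m" and \<nu>[measurable_cong]: "sets \<nu> = sets borel" and inv: "invariant_measure m \<nu>"
    and P: "AE x in \<nu>. P x"
  shows "AE x in \<nu>. AE y in m x. P y"
proof -
  note [measurable] = mrw_space_measurable[OF m]
  have m_sets: "sets (m x) = sets borel" for x using m by (simp add: mrw_space_def)
  obtain N where N: "{x \<in> space \<nu>. \<not> P x} \<subseteq> N" "N \<in> sets \<nu>" "emeasure \<nu> N = 0"
    using P by (auto elim: AE_E)
  have N'[measurable]: "N \<in> sets borel" using N \<nu> by simp
  have "(\<integral>\<^sup>+x. emeasure (m x) N \<partial>\<nu>) = 0"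
    using inv N N' by (simp add: invariant_measure_def)
  then have "AE x in \<nu>. emeasure (m x) N = 0"
    by (subst (asm) nn_integral_0_iff_AE) auto
  then show ?thesis
  proof eventually_elim
    case (elim x)
    then show ?case
      using N sets_eq_imp_space_eq[OF m_sets, of x] sets_eq_imp_space_eq[OF \<nu>]
      by (intro AE_I[of _ _ N]) (auto simp: m_sets)
  qed
qed

text \<open>Frees \<open>Fisher_I\<close> from the density chosen by \<open>SOME\<close>: two
  densities agree \<open>\<nu>\<close>-almost everywhere, and by invariance also at
  \<open>m x\<close>-almost every \<open>y\<close> for almost every \<open>x\<close>, so
  \<open>H_m\<close> does not distinguish them.\<close>

lemma Fisher_I_eq:
  fixes m :: "'a::polish_space \<Rightarrow> 'a measure"
  assumes m: "mrw_space m" and "prob_space \<nu>" and \<nu>[measurable_cong]: "sets \<nu> = sets borel"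
    and inv: "invariant_measure m \<nu>" and h: "is_density \<nu> \<mu> h"
  shows "Fisher_I m \<nu> \<mu> = 2 * H_m m \<nu> (\<lambda>x. sqrt (h x))"
proof -
  interpret prob_space \<nu> by fact
  define f where "f = (SOME f. is_density \<nu> \<mu> f)"
  have f: "is_density \<nu> \<mu> f" unfolding f_def by (rule someI[of "is_density \<nu> \<mu>", OF h])
  have [measurable]: "f \<in> borel_measurable borel" "h \<in> borel_measurable borel"
    using f h by (auto simp: is_density_def)
  have "AE x in \<nu>. ennreal (f x) = ennreal (h x)"
    using f h by (subst density_unique_iff[symmetric]) (auto simp: is_density_def)
  then have fh: "AE x in \<nu>. f x = h x"
    using f h by (auto simp: is_density_def)
  have "H_m m \<nu> (\<lambda>x. sqrt (f x)) = H_m m \<nu> (\<lambda>x. sqrt (h x))"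
    unfolding H_m_def
  proof (rule nn_integral_cong_AE)
    show "AE x in \<nu>. (\<integral>\<^sup>+y. ennreal ((sqrt (f y) - sqrt (f x))\<^sup>2 / 2) \<partial>m x) =
        (\<integral>\<^sup>+y. ennreal ((sqrt (h y) - sqrt (h x))\<^sup>2 / 2) \<partial>m x)"
      using fh invariant_measure_AE[OF m \<nu> inv fh]
    proof eventually_elim
      case (elim x)
      show ?case
        using elim(2) by (intro nn_integral_cong_AE) (auto simp: elim(1))
    qed
  qed
  then show ?thesis
    using h by (auto simp: Fisher_I_def f_def)
qed

section \<open>Dirichlet form of exponentials\<close>

text \<open>The trapezoidal rule overestimates the integral of the convex function
  \<open>exp\<close> over \<open>[b, a]\<close>. After division by \<open>exp b\<close> this is
  \<open>\<phi> (a - b) \<ge> 0\<close>, where \<open>\<phi> 0 = 0\<close> and \<open>\<phi>\<close>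
  increases because \<open>1 - t \<le> exp (- t)\<close>.\<close>

lemma exp_diff_le_trapezoid:
  fixes a b :: real
  assumes "b \<le> a"
  shows "exp a - exp b \<le> (a - b) * (exp a + exp b) / 2"
proof -
  define \<phi> where "\<phi> t = t * (exp t + 1) / 2 - (exp t - 1)" for t :: real
  have deriv: "(\<phi> has_real_derivative (1 - (1 - t) * exp t) / 2) (at t)" for t
    unfolding \<phi>_def by (auto intro!: derivative_eq_intros simp: field_simps)
  have nonneg: "0 \<le> (1 - (1 - t) * exp t) / 2" for t :: real
  proof -
    have "(1 - t) * exp t \<le> exp (- t) * exp t"
      using exp_ge_add_one_self[of "- t"] by (intro mult_right_mono) simp_all
    moreover have "exp (- t) * exp t = 1" by (simp add: exp_minus)
    ultimately have "(1 - t) * exp t \<le> 1" by (rule ord_le_eq_trans)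
    then have "0 \<le> 1 - (1 - t) * exp t" by (simp only: diff_ge_0_iff_ge)
    then show ?thesis by (rule divide_nonneg_nonneg) simp
  qed
  have "\<phi> 0 \<le> \<phi> (a - b)"
    by (rule DERIV_nonneg_imp_nondecreasing) (use assms deriv nonneg in \<open>simp_all only: diff_ge_0_iff_ge, metis\<close>)
  then have "0 \<le> exp b * \<phi> (a - b)" by (simp add: \<phi>_def)
  also have "\<dots> = (a - b) * (exp b * exp (a - b) + exp b) / 2 - (exp b * exp (a - b) - exp b)"
    unfolding \<phi>_def by algebra
  also have "exp b * exp (a - b) = exp a" by (simp add: exp_diff)
  finally show ?thesis by simp
qed

text \<open>Squaring the trapezoid bound and using convexity of the square. Keeping the mean of
  \<open>exp (2 * a)\<close> and \<open>exp (2 * b)\<close> instead of bounding by their sum saves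
  the factor \<open>2\<close> that the final constant depends on.\<close>

lemma exp_diff_square_le:
  fixes a b :: real
  shows "(exp a - exp b)\<^sup>2 \<le> (a - b)\<^sup>2 * (exp (2 * a) + exp (2 * b)) / 2"
proof -
  have "\<bar>exp a - exp b\<bar> \<le> \<bar>a - b\<bar> * ((exp a + exp b) / 2)"
    using exp_diff_le_trapezoid[of a b] exp_diff_le_trapezoid[of b a]
    by (cases "b \<le> a") (auto simp: add.commute)
  then have "\<bar>exp a - exp b\<bar>\<^sup>2 \<le> (\<bar>a - b\<bar> * ((exp a + exp b) / 2))\<^sup>2"
    by (rule power_mono) simp
  also have "\<dots> = (a - b)\<^sup>2 * ((exp a + exp b) / 2)\<^sup>2"
    by (simp only: power_mult_distrib power2_abs)
  also have "\<dots> \<le> (a - b)\<^sup>2 * (((exp a)\<^sup>2 + (exp b)\<^sup>2) / 2)"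
  proof (rule mult_left_mono)
    show "((exp a + exp b) / 2)\<^sup>2 \<le> ((exp a)\<^sup>2 + (exp b)\<^sup>2) / 2"
    proof -
      have "((u + v) / 2)\<^sup>2 \<le> (u\<^sup>2 + v\<^sup>2) / 2" for u v :: real
        using zero_le_power2[of "u - v"] by (simp add: power2_eq_square field_simps)
      then show ?thesis .
    qed
  qed simp
  also have "(exp a)\<^sup>2 = exp (2 * a)" by (rule exp_double[symmetric])
  also have "(exp b)\<^sup>2 = exp (2 * b)" by (rule exp_double[symmetric])
  finally show ?thesis by (simp only: power2_abs times_divide_eq_right)
qed

text \<open>The Lipschitz property reduces the Dirichlet form to double integrals of
  \<open>(dist x y)\<^sup>2 * E x\<close> and \<open>(dist x y)\<^sup>2 * E y\<close>. The first is
  controlled by \<open>Theta\<close>, and reversibility identifies the second with it.\<close>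

lemma Fisher_I_exp_le:
  fixes m :: "'a::polish_space \<Rightarrow> 'a measure" and f :: "'a \<Rightarrow> real"
  assumes m: "mrw_space m" and prob: "prob_space \<nu>" and \<nu>[measurable_cong]: "sets \<nu> = sets borel"
    and inv: "invariant_measure m \<nu>" and rev: "reversible_measure m \<nu>"
    and Theta: "Theta m \<nu> < \<infinity>"
    and f: "bounded (range f)" "1-lipschitz_on UNIV f"
    and Z: "Z = (\<integral>x. exp (l * f x) \<partial>\<nu>)" "0 < Z"
  shows "Fisher_I m \<nu> (density \<nu> (\<lambda>x. ennreal (exp (l * f x) / Z)))
    \<le> ennreal (l\<^sup>2 * enn2real (Theta m \<nu>) / 2)"
proof -
  interpret prob_space \<nu> by fact
  note [measurable] = mrw_space_measurable[OF m] lipschitz_borel_measurable[OF f(2)]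
  have m_sets[measurable_cong]: "sets (m x) = sets borel" for x using m by (simp add: mrw_space_def)
  obtain B where B: "\<And>x. \<bar>f x\<bar> \<le> B" using f(1) by (auto simp: bounded_iff)
  define \<theta> where "\<theta> = enn2real (Theta m \<nu>)"
  have \<theta>: "Theta m \<nu> = ennreal \<theta>" "0 \<le> \<theta>" using Theta by (auto simp: \<theta>_def less_top)
  define E where "E x = exp (l * f x)" for x
  have E_meas[measurable]: "E \<in> borel_measurable borel" unfolding E_def by measurable
  have "integrable \<nu> E"
  proof (rule integrable_const_bound[where B="exp (\<bar>l\<bar> * B)"])
    show "AE x in \<nu>. norm (E x) \<le> exp (\<bar>l\<bar> * B)"
    proof (rule AE_I2)
      fix x
      have "l * f x \<le> \<bar>l\<bar> * B"
        using abs_ge_self[of "l * f x"] mult_left_mono[OF B[of x], of "\<bar>l\<bar>"] by (simp add: abs_mult)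
      then show "norm (E x) \<le> exp (\<bar>l\<bar> * B)" by (simp add: E_def)
    qed
  qed simp
  then have intE: "(\<integral>\<^sup>+x. ennreal (E x) \<partial>\<nu>) = ennreal Z"
    by (subst nn_integral_eq_integral) (auto simp: Z(1) E_def[abs_def])
  \<comment> \<open>\<open>Theta\<close> contains half the squared distance, hence the factor
    \<open>2\<close> in the bound \<open>2 * \<theta> * Z\<close>.\<close>
  define G where "G = (\<integral>\<^sup>+x. \<integral>\<^sup>+y. ennreal ((dist x y)\<^sup>2 * E x) \<partial>m x \<partial>\<nu>)"
  have "G \<le> (\<integral>\<^sup>+x. ennreal (2 * E x) * ennreal \<theta> \<partial>\<nu>)"
    unfolding G_def
  proof (rule nn_integral_mono_AE)
    have "AE x in \<nu>. (\<integral>\<^sup>+y. ennreal ((dist x y)\<^sup>2 / 2) \<partial>m x) \<le> ennreal \<theta>"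
      using esssup_AE[of "\<lambda>x. \<integral>\<^sup>+y. ennreal ((dist x y)\<^sup>2 / 2) \<partial>m x" \<nu>]
      by (simp add: \<theta>(1)[symmetric] Theta_def)
    then show "AE x in \<nu>. (\<integral>\<^sup>+y. ennreal ((dist x y)\<^sup>2 * E x) \<partial>m x) \<le> ennreal (2 * E x) * ennreal \<theta>"
    proof eventually_elim
      case (elim x)
      have "(\<integral>\<^sup>+y. ennreal ((dist x y)\<^sup>2 * E x) \<partial>m x) =
          (\<integral>\<^sup>+y. ennreal (2 * E x) * ennreal ((dist x y)\<^sup>2 / 2) \<partial>m x)"
        by (intro nn_integral_cong) (simp add: E_def mult.commute flip: ennreal_mult)
      also have "\<dots> = ennreal (2 * E x) * (\<integral>\<^sup>+y. ennreal ((dist x y)\<^sup>2 / 2) \<partial>m x)"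
        by (intro nn_integral_cmult) measurable
      finally show ?case using elim by (simp add: mult_left_mono)
    qed
  qed
  also have "\<dots> = ennreal (2 * \<theta> * Z)"
  proof -
    have "(\<integral>\<^sup>+x. ennreal (2 * E x) * ennreal \<theta> \<partial>\<nu>) = (\<integral>\<^sup>+x. ennreal (2 * \<theta>) * ennreal (E x) \<partial>\<nu>)"
      using \<theta> by (intro nn_integral_cong) (simp add: E_def ac_simps flip: ennreal_mult)
    also have "\<dots> = ennreal (2 * \<theta> * Z)"
      using \<theta> Z(2) by (simp add: nn_integral_cmult intE ennreal_mult)
    finally show ?thesis .
  qed
  finally have G: "G \<le> ennreal (2 * \<theta> * Z)" .
  have G': "(\<integral>\<^sup>+x. \<integral>\<^sup>+y. ennreal ((dist x y)\<^sup>2 * E y) \<partial>m x \<partial>\<nu>) = G"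
    unfolding G_def
    using reversible_measure_nn_integral[OF m \<nu> rev, of "\<lambda>z. ennreal ((dist (fst z) (snd z))\<^sup>2 * E (fst z))"]
    by (simp add: dist_commute)
  \<comment> \<open>\<open>16 = 4 * 2 * 2\<close>: the square roots halve the exponent
    \<open>l * f\<close>, which gives \<open>4\<close> after squaring,
    \<open>exp_diff_square_le\<close> gives one \<open>2\<close> and \<open>H_m\<close> the other.
    The factor \<open>1 / Z\<close> normalises the density.\<close>
  define c where "c = l\<^sup>2 / (16 * Z)"
  have c: "0 \<le> c" using Z by (simp add: c_def)
  have pointwise: "(sqrt (E y / Z) - sqrt (E x / Z))\<^sup>2 / 2 \<le> c * ((dist x y)\<^sup>2 * E x + (dist x y)\<^sup>2 * E y)" for x y
  proof -
    have sqrtE: "sqrt (E x) = exp (l * f x / 2)" for x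
      by (intro real_sqrt_unique) (auto simp: E_def power2_eq_square simp flip: exp_add)
    have "\<bar>f y - f x\<bar> \<le> dist x y"
      using lipschitz_onD[OF f(2), of y x] by (simp add: dist_real_def dist_commute)
    then have "(f y - f x)\<^sup>2 \<le> (dist x y)\<^sup>2"
      using power_mono[of "\<bar>f y - f x\<bar>" "dist x y" 2] by simp
    moreover have "(sqrt (E y) - sqrt (E x))\<^sup>2 \<le> l\<^sup>2 / 8 * ((f y - f x)\<^sup>2 * (E x + E y))"
    proof -
      have "(sqrt (E y) - sqrt (E x))\<^sup>2 \<le> (l * f y / 2 - l * f x / 2)\<^sup>2 * (E y + E x) / 2"
        using exp_diff_square_le[of "l * f y / 2" "l * f x / 2"]
        unfolding sqrtE by (simp add: E_def)
      also have "\<dots> = l\<^sup>2 / 8 * ((f y - f x)\<^sup>2 * (E x + E y))"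
        by (simp add: power2_eq_square field_simps)
      finally show ?thesis .
    qed
    ultimately have "(sqrt (E y) - sqrt (E x))\<^sup>2 \<le> l\<^sup>2 / 8 * ((dist x y)\<^sup>2 * (E x + E y))"
      by (elim order_trans) (intro mult_left_mono mult_right_mono; simp add: E_def add_nonneg_nonneg)
    moreover have "(sqrt (E y / Z) - sqrt (E x / Z))\<^sup>2 = (sqrt (E y) - sqrt (E x))\<^sup>2 / Z"
      using Z(2) by (simp add: real_sqrt_divide diff_divide_distrib[symmetric] power_divide)
    ultimately show ?thesis
      using Z(2) by (simp add: c_def field_simps)
  qed
  have "H_m m \<nu> (\<lambda>x. sqrt (E x / Z)) \<le>
    (\<integral>\<^sup>+x. \<integral>\<^sup>+y. ennreal c * (ennreal ((dist x y)\<^sup>2 * E x) + ennreal ((dist x y)\<^sup>2 * E y)) \<partial>m x \<partial>\<nu>)"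
    unfolding H_m_def
  proof (intro nn_integral_mono)
    fix x y
    show "ennreal ((sqrt (E y / Z) - sqrt (E x / Z))\<^sup>2 / 2) \<le>
      ennreal c * (ennreal ((dist x y)\<^sup>2 * E x) + ennreal ((dist x y)\<^sup>2 * E y))"
      using pointwise[of y x] c by (simp add: E_def flip: ennreal_mult ennreal_plus)
  qed
  also have "\<dots> = ennreal c * (G + (\<integral>\<^sup>+x. \<integral>\<^sup>+y. ennreal ((dist x y)\<^sup>2 * E y) \<partial>m x \<partial>\<nu>))"
  proof -
    have M: "(\<lambda>x. \<integral>\<^sup>+y. ennreal ((dist x y)\<^sup>2 * E x) \<partial>m x) \<in> borel_measurable \<nu>"
      "(\<lambda>x. \<integral>\<^sup>+y. ennreal ((dist x y)\<^sup>2 * E y) \<partial>m x) \<in> borel_measurable \<nu>"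
      by (rule nn_integral_measurable_subprob_algebra2[where N=borel]; measurable)+
    have "(\<integral>\<^sup>+y. ennreal c * (ennreal ((dist x y)\<^sup>2 * E x) + ennreal ((dist x y)\<^sup>2 * E y)) \<partial>m x) =
      ennreal c * ((\<integral>\<^sup>+y. ennreal ((dist x y)\<^sup>2 * E x) \<partial>m x) + (\<integral>\<^sup>+y. ennreal ((dist x y)\<^sup>2 * E y) \<partial>m x))" for x
      by (subst nn_integral_cmult, measurable) (subst nn_integral_add; measurable)
    then show ?thesis
      using M unfolding G_def by (simp add: nn_integral_cmult nn_integral_add)
  qed
  also have "\<dots> \<le> ennreal c * (ennreal (2 * \<theta> * Z) + ennreal (2 * \<theta> * Z))"
    unfolding G' using G by (intro mult_left_mono add_mono) auto
  also have "\<dots> = ennreal (l\<^sup>2 * \<theta> / 4)"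
    using \<theta> Z c by (simp add: c_def flip: ennreal_plus ennreal_mult)
  finally have "2 * H_m m \<nu> (\<lambda>x. sqrt (E x / Z)) \<le> 2 * ennreal (l\<^sup>2 * \<theta> / 4)"
    by (rule mult_left_mono) simp
  also have "\<dots> = ennreal (2 * (l\<^sup>2 * \<theta> / 4))"
    using \<theta> by (subst ennreal_mult) auto
  finally have "2 * H_m m \<nu> (\<lambda>x. sqrt (E x / Z)) \<le> ennreal (l\<^sup>2 * \<theta> / 2)"
    by (simp add: mult.commute)
  moreover have "is_density \<nu> (density \<nu> (\<lambda>x. ennreal (E x / Z))) (\<lambda>x. E x / Z)"
    using Z(2) by (auto simp: is_density_def E_def)
  ultimately show ?thesis
    using Fisher_I_eq[OF m prob \<nu> inv] by (simp add: E_def \<theta>_def)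
qed

section \<open>Moment generating functions and entropy\<close>

text \<open>An explicit second-order remainder, from
  \<open>u \<le> exp u - 1 \<le> u * exp u\<close>. For bounded \<open>f\<close> it is uniform in
  the point, which permits differentiation under the integral.\<close>

lemma abs_exp_sub_linear_le:
  fixes u :: real
  shows "\<bar>exp u - 1 - u\<bar> \<le> u\<^sup>2 * exp \<bar>u\<bar>"
proof -
  have lower: "u \<le> exp u - 1" and upper: "exp u - 1 \<le> u * exp u" for u :: real
  proof -
    show "u \<le> exp u - 1" using exp_ge_add_one_self[of u] by linarith
    have "(1 - u) * exp u \<le> exp (- u) * exp u"
      using exp_ge_add_one_self[of "- u"] by (intro mult_right_mono) simp_all
    also have "\<dots> = 1" by (simp add: exp_minus)
    finally show "exp u - 1 \<le> u * exp u" by (simp add: left_diff_distrib)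
  qed
  have "exp u - 1 - u \<le> u * (exp u - 1)"
    using upper[of u] by (simp only: right_diff_distrib mult_1_right)
  also have "\<dots> \<le> u * (u * exp \<bar>u\<bar>)"
  proof (cases "0 \<le> u")
    case True
    then show ?thesis using upper[of u] by (intro mult_left_mono) simp_all
  next
    case False
    have "u * exp \<bar>u\<bar> \<le> u * 1" using False by (intro mult_left_mono_neg) simp_all
    also have "\<dots> \<le> exp u - 1" using lower[of u] by simp
    finally show ?thesis using False by (intro mult_left_mono_neg) simp_all
  qed
  finally show ?thesis using lower[of u] by (simp add: power2_eq_square)
qed

lemma (in prob_space) integrable_bounded:
  fixes f :: "'a \<Rightarrow> real"
  assumes "f \<in> borel_measurable M" "\<And>x. \<bar>f x\<bar> \<le> B"
  shows "integrable M f"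
  using assms by (intro integrable_const_bound[where B=B]) auto

lemma (in prob_space) mgf_has_derivative:
  fixes f :: "'a \<Rightarrow> real"
  assumes [measurable]: "f \<in> borel_measurable M" and B: "\<And>x. \<bar>f x\<bar> \<le> B"
  shows "((\<lambda>l. \<integral>x. exp (l * f x) \<partial>M) has_real_derivative (\<integral>x. f x * exp (l * f x) \<partial>M)) (at l)"
proof -
  have B0: "0 \<le> B" using B order_trans[OF abs_ge_zero] by blast
  have lB: "\<bar>l * f x\<bar> \<le> \<bar>l\<bar> * B" for l x using B by (simp add: abs_mult mult_left_mono)
  have int: "integrable M (\<lambda>x. exp (l * f x))" for l
    using abs_le_D1[OF lB] by (intro integrable_bounded[where B="exp (\<bar>l\<bar> * B)"]) simp_all
  have int': "integrable M (\<lambda>x. f x * exp (l * f x))" for l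
    using abs_le_D1[OF lB] B B0
    by (intro integrable_bounded[where B="B * exp (\<bar>l\<bar> * B)"]) (simp, simp add: abs_mult mult_mono)
  define Z where "Z l = (\<integral>x. exp (l * f x) \<partial>M)" for l
  define G where "G = (\<integral>x. f x * exp (l * f x) \<partial>M)"
  \<comment> \<open>\<open>exp (\<bar>l\<bar> * B)\<close> bounds the factor
    \<open>exp (l * f x)\<close>; for \<open>\<bar>d\<bar> \<le> 1\<close>,
    \<open>d\<^sup>2 * (B\<^sup>2 * exp B)\<close> bounds the remainder at
    \<open>d * f x\<close>.\<close>
  define c where "c = exp (\<bar>l\<bar> * B) * (B\<^sup>2 * exp B)"
  have bound: "\<bar>(Z (l + d) - Z l) / d - G\<bar> \<le> c * \<bar>d\<bar>" if d: "d \<noteq> 0" "\<bar>d\<bar> \<le> 1" for d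
  proof -
    have pw: "\<bar>exp ((l + d) * f x) - exp (l * f x) - d * (f x * exp (l * f x))\<bar> \<le> c * d\<^sup>2" for x
    proof -
      have "exp ((l + d) * f x) - exp (l * f x) - d * (f x * exp (l * f x)) =
          exp (l * f x) * (exp (d * f x) - 1 - d * f x)"
        by (simp add: distrib_right exp_add right_diff_distrib)
      then have "\<bar>exp ((l + d) * f x) - exp (l * f x) - d * (f x * exp (l * f x))\<bar> =
          exp (l * f x) * \<bar>exp (d * f x) - 1 - d * f x\<bar>"
        by (simp only: abs_mult abs_exp_cancel)
      also have "\<dots> \<le> exp (\<bar>l\<bar> * B) * ((d * f x)\<^sup>2 * exp \<bar>d * f x\<bar>)"
        using abs_exp_sub_linear_le[of "d * f x"] abs_le_D1[OF lB[of l x]] by (intro mult_mono) simp_all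
      also have "\<dots> \<le> exp (\<bar>l\<bar> * B) * ((d\<^sup>2 * B\<^sup>2) * exp B)"
      proof (intro mult_left_mono mult_mono)
        show "(d * f x)\<^sup>2 \<le> d\<^sup>2 * B\<^sup>2"
          using power_mono[OF B[of x], of 2] by (simp add: power_mult_distrib mult_left_mono)
        have "\<bar>d * f x\<bar> \<le> 1 * B"
          unfolding abs_mult using d B by (intro mult_mono) auto
        then show "exp \<bar>d * f x\<bar> \<le> exp B" by simp
      qed simp_all
      finally show ?thesis by (simp add: c_def mult_ac)
    qed
    have eq: "Z (l + d) - Z l - d * G = (\<integral>x. exp ((l + d) * f x) - exp (l * f x) - d * (f x * exp (l * f x)) \<partial>M)"
      using int[of "l + d"] int[of l] int'[of l] by (simp add: Z_def G_def)
    have "\<bar>Z (l + d) - Z l - d * G\<bar> \<le>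
        (\<integral>x. \<bar>exp ((l + d) * f x) - exp (l * f x) - d * (f x * exp (l * f x))\<bar> \<partial>M)"
      unfolding eq by (rule integral_abs_bound)
    also have "\<dots> \<le> (\<integral>x. c * d\<^sup>2 \<partial>M)"
      by (intro integral_mono pw integrable_abs Bochner_Integration.integrable_diff int
          integrable_mult_right int' integrable_const)
    also have "\<dots> = c * d\<^sup>2" by (simp add: prob_space)
    finally have "\<bar>Z (l + d) - Z l - d * G\<bar> \<le> c * d\<^sup>2" .
    then have "\<bar>Z (l + d) - Z l - d * G\<bar> / \<bar>d\<bar> \<le> c * d\<^sup>2 / \<bar>d\<bar>"
      by (rule divide_right_mono) simp
    moreover have "(Z (l + d) - Z l) / d - G = (Z (l + d) - Z l - d * G) / d"
      using d by (simp add: diff_divide_distrib)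
    moreover have "c * d\<^sup>2 / \<bar>d\<bar> = c * \<bar>d\<bar>"
      using d by (simp add: power2_eq_square abs_if)
    ultimately show ?thesis by (simp only: abs_divide)
  qed
  have "((\<lambda>d. (Z (l + d) - Z l) / d - G) \<longlongrightarrow> 0) (at 0)"
  proof (rule Lim_null_comparison)
    show "\<forall>\<^sub>F d in at 0. norm ((Z (l + d) - Z l) / d - G) \<le> c * \<bar>d\<bar>"
      unfolding eventually_at using bound by (intro exI[of _ 1]) simp
    show "((\<lambda>d. c * \<bar>d\<bar>) \<longlongrightarrow> 0) (at 0)"
      by (intro tendsto_mult_right_zero tendsto_rabs_zero tendsto_ident_at)
  qed
  then have "((\<lambda>d. (Z (l + d) - Z l) / d) \<longlongrightarrow> G) (at 0)"
    by (rule LIM_zero_cancel)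
  then show ?thesis by (simp add: DERIV_def Z_def G_def)
qed

text \<open>Gronwall's argument: \<open>growth\<close> says \<open>Z' \<le> c * l * Z\<close>, so
  \<open>Z l * exp (- (c * l\<^sup>2 / 2))\<close> is nonincreasing for \<open>l \<ge> 0\<close> and
  starts at \<open>1\<close>.\<close>

lemma (in prob_space) mgf_le_gaussian:
  fixes f :: "'a \<Rightarrow> real"
  assumes [measurable]: "f \<in> borel_measurable M" and B: "\<And>x. \<bar>f x\<bar> \<le> B"
    and growth: "\<And>l. 0 \<le> l \<Longrightarrow> (\<integral>x. f x * exp (l * f x) \<partial>M) \<le> c * l * (\<integral>x. exp (l * f x) \<partial>M)"
    and "0 \<le> l"
  shows "(\<integral>x. exp (l * f x) \<partial>M) \<le> exp (c * l\<^sup>2 / 2)"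
proof -
  define Z where "Z l = (\<integral>x. exp (l * f x) \<partial>M)" for l
  define G where "G l = (\<integral>x. f x * exp (l * f x) \<partial>M)" for l
  have Z': "(Z has_real_derivative G l) (at l)" for l
    using mgf_has_derivative[OF assms(1) B, of l] by (simp add: Z_def[abs_def] G_def)
  have gauss': "((\<lambda>l. exp (- (c * l\<^sup>2 / 2))) has_real_derivative - (c * l) * exp (- (c * l\<^sup>2 / 2))) (at l)" for l
    by (auto intro!: derivative_eq_intros)
  have "Z l * exp (- (c * l\<^sup>2 / 2)) \<le> Z 0 * exp (- (c * 0\<^sup>2 / 2))"
  proof (rule DERIV_nonpos_imp_nonincreasing[OF \<open>0 \<le> l\<close>])
    fix t :: real assume "0 \<le> t"
    have "G t * exp (- (c * t\<^sup>2 / 2)) + - (c * t) * exp (- (c * t\<^sup>2 / 2)) * Z t =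
        (G t - c * t * Z t) * exp (- (c * t\<^sup>2 / 2))" by algebra
    also have "\<dots> \<le> 0"
      using growth[OF \<open>0 \<le> t\<close>] by (intro mult_nonpos_nonneg) (simp_all add: G_def Z_def)
    finally have nonpos: "G t * exp (- (c * t\<^sup>2 / 2)) + - (c * t) * exp (- (c * t\<^sup>2 / 2)) * Z t \<le> 0" .
    show "\<exists>y. ((\<lambda>l. Z l * exp (- (c * l\<^sup>2 / 2))) has_real_derivative y) (at t) \<and> y \<le> 0"
    proof (intro exI conjI)
      show "((\<lambda>l. Z l * exp (- (c * l\<^sup>2 / 2))) has_real_derivative
          G t * exp (- (c * t\<^sup>2 / 2)) + - (c * t) * exp (- (c * t\<^sup>2 / 2)) * Z t) (at t)"
        by (rule DERIV_mult[OF Z' gauss'])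
    qed (rule nonpos)
  qed
  also have "\<dots> = 1" by (simp add: Z_def prob_space)
  finally have "Z l * exp (- (c * l\<^sup>2 / 2)) \<le> 1" .
  from mult_right_mono[OF this exp_ge_zero[of "c * l\<^sup>2 / 2"]]
  have "Z l * exp (- (c * l\<^sup>2 / 2)) * exp (c * l\<^sup>2 / 2) \<le> 1 * exp (c * l\<^sup>2 / 2)" .
  moreover have "Z l * exp (- (c * l\<^sup>2 / 2)) * exp (c * l\<^sup>2 / 2) = Z l"
    by (simp add: exp_minus)
  ultimately show ?thesis by (simp only: mult_1_left Z_def)
qed

section \<open>Variational bound for the entropy\<close>

text \<open>Young's inequality for the conjugate pair \<open>t ln t - t\<close> and
  \<open>exp g\<close>: multiply \<open>1 + u \<le> exp u\<close> at \<open>u = g - ln t\<close> by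
  \<open>t\<close>.\<close>

lemma xlogx_young:
  assumes "0 \<le> t"
  shows "g * t \<le> xlogx t - t + exp g"
proof (cases "t = 0")
  case False
  with assms have t: "0 < t" by simp
  have "t * (1 + (g - ln t)) \<le> t * exp (g - ln t)"
    using t exp_ge_add_one_self[of "g - ln t"] by (intro mult_left_mono) simp_all
  also have "\<dots> = exp g" using t by (simp add: exp_diff)
  finally show ?thesis using t by (simp add: xlogx_def algebra_simps)
qed (simp add: xlogx_def)

lemma (in prob_space) density_integral_eq_1:
  assumes [measurable]: "h \<in> borel_measurable M" and h: "\<And>x. 0 \<le> h x"
    and prob: "prob_space (density M (\<lambda>x. ennreal (h x)))"
  shows "integrable M h" "(\<integral>x. h x \<partial>M) = 1"
proof -
  have *: "(\<integral>\<^sup>+x. ennreal (h x) \<partial>M) = 1"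
    using prob_space.emeasure_space_1[OF prob] by (simp add: emeasure_density cong: nn_integral_cong)
  then show "integrable M h" using h by (intro integrableI_nonneg) auto
  then show "(\<integral>x. h x \<partial>M) = 1" using h * by (simp add: integral_eq_nn_integral)
qed

text \<open>One half of the Gibbs (Donsker-Varadhan) formula. Young's inequality is applied to
  \<open>g - ln Z\<close>; upon integration \<open>h\<close> and \<open>exp g / Z\<close> both give
  \<open>1\<close> and cancel.\<close>

lemma (in prob_space) entropy_variational:
  assumes [measurable]: "h \<in> borel_measurable M" "g \<in> borel_measurable M"
    and h: "\<And>x. 0 \<le> h x" and prob: "prob_space (density M (\<lambda>x. ennreal (h x)))"
    and ent: "integrable M (\<lambda>x. xlogx (h x))" and B: "\<And>x. \<bar>g x\<bar> \<le> B"
  shows "(\<integral>x. g x \<partial>density M (\<lambda>x. ennreal (h x))) \<le> (\<integral>x. xlogx (h x) \<partial>M) + ln (\<integral>x. exp (g x) \<partial>M)"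
proof -
  note h1 = density_integral_eq_1[OF assms(1) h prob]
  have int_exp: "integrable M (\<lambda>x. exp (g x))"
    using B[THEN abs_le_D1] by (intro integrable_bounded[where B="exp B"]) simp_all
  have int_gh: "integrable M (\<lambda>x. g x * h x)"
  proof (rule Bochner_Integration.integrable_bound)
    show "integrable M (\<lambda>x. B * h x)" using h1 by simp
    show "AE x in M. norm (g x * h x) \<le> norm (B * h x)"
    proof (rule AE_I2)
      fix x
      have "\<bar>g x\<bar> * h x \<le> \<bar>B\<bar> * h x"
        using h by (intro mult_right_mono order_trans[OF B abs_ge_self])
      then show "norm (g x * h x) \<le> norm (B * h x)" using h[of x] by (simp add: abs_mult)
    qed
  qed simp
  define Z where "Z = (\<integral>x. exp (g x) \<partial>M)"
  have "(\<integral>x. exp (- B) \<partial>M) \<le> Z"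
    unfolding Z_def using int_exp abs_le_D2[OF B] by (intro integral_mono) (auto simp: minus_le_iff)
  then have Z: "0 < Z" by (simp add: prob_space) (metis exp_gt_zero less_le_trans)
  have "(\<integral>x. g x * h x - ln Z * h x \<partial>M) \<le> (\<integral>x. xlogx (h x) - h x + exp (g x) / Z \<partial>M)"
  proof (intro integral_mono)
    fix x
    show "g x * h x - ln Z * h x \<le> xlogx (h x) - h x + exp (g x) / Z"
      using xlogx_young[OF h, of "g x - ln Z" x] Z by (simp add: left_diff_distrib exp_diff)
  qed (use int_gh h1 ent int_exp in simp_all)
  then have "(\<integral>x. g x * h x \<partial>M) \<le> (\<integral>x. xlogx (h x) \<partial>M) + ln Z"
    using int_gh h1 ent int_exp Z by (simp flip: Z_def)
  moreover have "(\<integral>x. g x \<partial>density M (\<lambda>x. ennreal (h x))) = (\<integral>x. g x * h x \<partial>M)"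
    using h by (subst integral_density) (auto simp: mult.commute)
  ultimately show ?thesis by (simp add: Z_def)
qed

text \<open>For \<open>D > 0\<close> the optimal choice is \<open>l = D / c\<close>. There
  \<open>c = 0\<close> cannot occur, since a linear function of \<open>l\<close> with positive slope
  is unbounded; \<open>l = (e + 1) / D\<close> shows this.\<close>

lemma le_sqrt_of_quadratic_bound:
  fixes D e c :: real
  assumes "0 \<le> c" and bound: "\<And>l. 0 \<le> l \<Longrightarrow> l * D \<le> e + c * l\<^sup>2 / 2"
  shows "D \<le> sqrt (2 * c * e)"
proof (cases "D \<le> 0")
  case True
  have "0 \<le> e" using bound[of 0] by simp
  then show ?thesis using True assms(1) by (meson mult_nonneg_nonneg order_trans real_sqrt_ge_zero zero_le_numeral)
next
  case False
  then have D: "0 < D" by simp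
  have e: "0 \<le> e" using bound[of 0] by simp
  have c: "0 < c"
  proof (rule ccontr)
    assume "\<not> 0 < c"
    then have "c = 0" using assms(1) by simp
    then show False using bound[of "(e + 1) / D"] D e by simp
  qed
  have "D / c * D \<le> e + c * (D / c)\<^sup>2 / 2" using D c by (intro bound) simp
  then have "D\<^sup>2 \<le> 2 * c * e" using c by (simp add: power2_eq_square field_simps)
  then show ?thesis by (rule real_le_rsqrt)
qed

text \<open>For a probability measure the density has integral \<open>1\<close>, and the correction
  term in \<open>Ent\<close> is \<open>xlogx 1 = 0\<close>.\<close>

lemma Ent_finite_obtain_density:
  assumes "prob_space \<nu>" "sets \<nu> = sets borel" "prob_space \<mu>" "Ent \<nu> \<mu> < \<infinity>"
  obtains h where "is_density \<nu> \<mu> h" "integrable \<nu> (\<lambda>x. xlogx (h x))"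
    "real_of_ereal (Ent \<nu> \<mu>) = (\<integral>x. xlogx (h x) \<partial>\<nu>)"
proof -
  interpret prob_space \<nu> by fact
  define P where "P h \<longleftrightarrow> is_density \<nu> \<mu> h \<and> integrable \<nu> (\<lambda>x. xlogx (h x))" for h
  have ex: "\<exists>h. P h" using assms(4) by (auto simp: Ent_def P_def split: if_splits)
  define h where "h = (SOME h. P h)"
  have h: "P h" unfolding h_def using ex by (rule someI_ex)
  have "(\<integral>x. h x \<partial>\<nu>) = 1"
    using h assms(2,3) by (intro density_integral_eq_1(2)) (auto simp: P_def is_density_def cong: measurable_cong_sets)
  then have "Ent \<nu> \<mu> = ereal (\<integral>x. xlogx (h x) \<partial>\<nu>)"
    using ex by (simp add: Ent_def h_def P_def Let_def) (simp add: xlogx_def)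
  then show ?thesis using h by (intro that[of h]) (auto simp: P_def)
qed

section \<open>From transport-information to transport-entropy\<close>

text \<open>The logarithmic derivative of the moment generating function at \<open>l\<close> is the
  mean of \<open>f\<close> under the tilted measure. As \<open>f\<close> is centred, this is a
  difference of means, bounded by \<open>W1\<close> and so by the root of the Fisher information
  over \<open>K\<close>, which is at most \<open>c * l\<close>.\<close>

lemma mgf_le_of_transport_information:
  fixes m :: "'a::polish_space \<Rightarrow> 'a measure" and f :: "'a \<Rightarrow> real"
  assumes m: "mrw_space m" and prob: "prob_space \<nu>" and \<nu>[measurable_cong]: "sets \<nu> = sets borel"
    and inv: "invariant_measure m \<nu>" and rev: "reversible_measure m \<nu>"
    and Theta: "Theta m \<nu> < \<infinity>" and "K > 0"
    and TI: "\<forall>\<mu>. prob_space \<mu> \<and> sets \<mu> = sets borel \<and> absolutely_continuous \<nu> \<mu> \<and>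
              Fisher_I m \<nu> \<mu> < \<infinity> \<longrightarrow>
            W1 \<mu> \<nu> \<le> ennreal (sqrt (enn2real (Fisher_I m \<nu> \<mu>)) / K)"
    and f: "bounded (range f)" "1-lipschitz_on UNIV f" and centered: "(\<integral>x. f x \<partial>\<nu>) = 0"
    and "0 \<le> l"
  shows "(\<integral>x. exp (l * f x) \<partial>\<nu>) \<le> exp (sqrt (enn2real (Theta m \<nu>) / 2) / K * l\<^sup>2 / 2)"
proof -
  interpret prob_space \<nu> by fact
  have [measurable]: "f \<in> borel_measurable borel" by (rule lipschitz_borel_measurable[OF f(2)])
  obtain B where B: "\<And>x. \<bar>f x\<bar> \<le> B" using f(1) by (auto simp: bounded_iff)
  define c where "c = sqrt (enn2real (Theta m \<nu>) / 2) / K"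
  have c: "0 \<le> c" using \<open>K > 0\<close> by (simp add: c_def)
  have "(\<integral>x. f x * exp (l * f x) \<partial>\<nu>) \<le> c * l * (\<integral>x. exp (l * f x) \<partial>\<nu>)" if l: "0 \<le> l" for l
  proof -
    define Z where "Z = (\<integral>x. exp (l * f x) \<partial>\<nu>)"
    have lB: "\<bar>l * f x\<bar> \<le> l * B" for x using B l by (simp add: abs_mult mult_left_mono)
    have int: "integrable \<nu> (\<lambda>x. exp (l * f x))"
      using abs_le_D1[OF lB] by (intro integrable_bounded[where B="exp (l * B)"]) simp_all
    have "(\<integral>x. exp (- (l * B)) \<partial>\<nu>) \<le> Z"
      unfolding Z_def
    proof (intro integral_mono int)
      show "exp (- (l * B)) \<le> exp (l * f x)" for x using abs_le_D2[OF lB[of x]] by simp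
    qed simp
    then have Z: "0 < Z" by (simp add: prob_space) (metis exp_gt_zero less_le_trans)
    define \<mu> where "\<mu> = density \<nu> (\<lambda>x. ennreal (exp (l * f x) / Z))"
    have I: "Fisher_I m \<nu> \<mu> \<le> ennreal (l\<^sup>2 * enn2real (Theta m \<nu>) / 2)"
      unfolding \<mu>_def by (rule Fisher_I_exp_le[OF m prob \<nu> inv rev Theta f Z_def Z])
    have "(\<integral>\<^sup>+x. ennreal (exp (l * f x) / Z) \<partial>\<nu>) = 1"
      using int Z by (subst nn_integral_eq_integral) (auto simp: Z_def[symmetric])
    then have "prob_space \<mu>"
      by (intro prob_spaceI) (simp add: \<mu>_def emeasure_density cong: nn_integral_cong)
    moreover have "sets \<mu> = sets borel" by (simp add: \<mu>_def \<nu>)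
    moreover have "absolutely_continuous \<nu> \<mu>"
      unfolding \<mu>_def by (rule absolutely_continuousI_density) measurable
    moreover have "Fisher_I m \<nu> \<mu> < \<infinity>" using I by (rule le_less_trans) simp
    ultimately have "W1 \<mu> \<nu> \<le> ennreal (sqrt (enn2real (Fisher_I m \<nu> \<mu>)) / K)" using TI by blast
    also have "\<dots> \<le> ennreal (l * c)"
    proof (rule ennreal_leI)
      have "enn2real (Fisher_I m \<nu> \<mu>) \<le> l\<^sup>2 * enn2real (Theta m \<nu>) / 2"
        using I by (intro enn2real_leI) simp_all
      then have "sqrt (enn2real (Fisher_I m \<nu> \<mu>)) \<le> sqrt (l\<^sup>2 * (enn2real (Theta m \<nu>) / 2))" by simp
      also have "\<dots> = l * sqrt (enn2real (Theta m \<nu>) / 2)" using l by (simp only: real_sqrt_mult real_sqrt_abs abs_of_nonneg)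
      finally show "sqrt (enn2real (Fisher_I m \<nu> \<mu>)) / K \<le> l * c"
        using \<open>K > 0\<close> by (simp add: c_def divide_right_mono)
    qed
    finally have "ennreal ((\<integral>x. f x \<partial>\<mu>) - (\<integral>x. f x \<partial>\<nu>)) \<le> ennreal (l * c)"
      using lipschitz_integral_diff_le_W1[OF f, of \<mu> \<nu>] by (rule order_trans[rotated])
    then have "(\<integral>x. f x \<partial>\<mu>) \<le> l * c"
      using l c centered by (simp add: ennreal_le_iff)
    moreover have "(\<integral>x. f x \<partial>\<mu>) = (\<integral>x. f x * exp (l * f x) \<partial>\<nu>) / Z"
      unfolding \<mu>_def using Z by (subst integral_density) (auto simp: mult.commute)
    ultimately show ?thesis using Z by (simp add: Z_def[symmetric] field_simps)
  qed
  then show ?thesis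
    unfolding c_def[symmetric] using \<open>0 \<le> l\<close> by (intro mgf_le_gaussian[OF _ B]) simp_all
qed

theorem theorem3p25:
  fixes m :: "'a::polish_space \<Rightarrow> 'a measure" and \<nu> :: "'a measure" and K :: real
  assumes "mrw_space m"
    and "prob_space \<nu>" and "sets \<nu> = sets borel"
    and "invariant_measure m \<nu>" and "reversible_measure m \<nu>"
    and "Theta m \<nu> < \<infinity>"
    and "\<exists>x0. (\<integral>\<^sup>+ x. ennreal (dist x x0) \<partial>\<nu>) < \<infinity>"
    and "K > 0"
    and "\<forall>\<mu>. prob_space \<mu> \<and> sets \<mu> = sets borel \<and> absolutely_continuous \<nu> \<mu> \<and>
              Fisher_I m \<nu> \<mu> < \<infinity> \<longrightarrow>
            W1 \<mu> \<nu> \<le> ennreal (sqrt (enn2real (Fisher_I m \<nu> \<mu>)) / K)"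
  shows "\<forall>\<mu>. prob_space \<mu> \<and> sets \<mu> = sets borel \<and> absolutely_continuous \<nu> \<mu> \<and>
              Ent \<nu> \<mu> < \<infinity> \<longrightarrow>
            W1 \<mu> \<nu> \<le> ennreal (sqrt (sqrt (2 * enn2real (Theta m \<nu>)) / K * real_of_ereal (Ent \<nu> \<mu>)))"
proof (intro allI impI, elim conjE)
  fix \<mu> :: "'a measure"
  assume \<mu>: "prob_space \<mu>" "sets \<mu> = sets borel" "Ent \<nu> \<mu> < \<infinity>"
  interpret prob_space \<nu> by fact
  note [measurable_cong] = assms(3) \<mu>(2)
  obtain x0 where x0: "(\<integral>\<^sup>+ x. ennreal (dist x x0) \<partial>\<nu>) < \<infinity>" using assms(7) by blast
  obtain h where h: "is_density \<nu> \<mu> h" "integrable \<nu> (\<lambda>x. xlogx (h x))"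
    "real_of_ereal (Ent \<nu> \<mu>) = (\<integral>x. xlogx (h x) \<partial>\<nu>)"
    using Ent_finite_obtain_density[OF assms(2,3) \<mu>(1,3)] by blast
  have h': "h \<in> borel_measurable \<nu>" "\<And>x. 0 \<le> h x" "\<mu> = density \<nu> (\<lambda>x. ennreal (h x))"
    using h(1) by (auto simp: is_density_def cong: measurable_cong_sets)
  define \<theta> where "\<theta> = enn2real (Theta m \<nu>)"
  define c where "c = sqrt (\<theta> / 2) / K"
  have c: "0 \<le> c" using assms(8) by (simp add: c_def \<theta>_def)
  have c2: "2 * c = sqrt (2 * \<theta>) / K"
  proof -
    have "sqrt (2 * \<theta>) = sqrt (2\<^sup>2 * (\<theta> / 2))" by simp
    also have "\<dots> = 2 * sqrt (\<theta> / 2)" by (simp only: real_sqrt_mult real_sqrt_power) simp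
    finally show ?thesis by (simp add: c_def)
  qed
  define e where "e = real_of_ereal (Ent \<nu> \<mu>)"
  have "W1 \<mu> \<nu> \<le> ennreal (sqrt (2 * c * e))"
  proof (rule W1_le_dual[OF \<mu>(1) assms(2) \<mu>(2) assms(3) x0])
    fix f :: "'a \<Rightarrow> real" assume f: "bounded (range f)" "1-lipschitz_on UNIV f"
    obtain B where B: "\<And>x. \<bar>f x\<bar> \<le> B" using f(1) by (auto simp: bounded_iff)
    have f_meas[measurable]: "f \<in> borel_measurable borel" by (rule lipschitz_borel_measurable[OF f(2)])
    \<comment> \<open>Centring makes the bound on the moment generating function applicable and does
      not affect the difference of the two means.\<close>
    define g where "g x = f x - (\<integral>x. f x \<partial>\<nu>)" for x
    have [measurable]: "g \<in> borel_measurable borel" unfolding g_def by measurable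
    have g: "1-lipschitz_on UNIV g"
      using f(2) by (simp add: lipschitz_on_def g_def dist_real_def)
    have gB: "\<bar>g x\<bar> \<le> B + \<bar>\<integral>x. f x \<partial>\<nu>\<bar>" for x
      using B[of x] by (simp add: g_def)
    have int_f: "integrable \<nu> f" using B by (intro integrable_bounded) simp_all
    have g_int: "(\<integral>x. g x \<partial>\<nu>) = 0"
      unfolding g_def by (subst Bochner_Integration.integral_diff) (simp_all add: int_f prob_space)
    have g_int\<mu>: "(\<integral>x. g x \<partial>\<mu>) = (\<integral>x. f x \<partial>\<mu>) - (\<integral>x. f x \<partial>\<nu>)"
    proof -
      interpret \<mu>: prob_space \<mu> by fact
      have "integrable \<mu> f" using B by (intro \<mu>.integrable_bounded) simp_all
      then show ?thesis
        unfolding g_def by (subst Bochner_Integration.integral_diff) (simp_all add: \<mu>.prob_space)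
    qed
    show "(\<integral>x. f x \<partial>\<mu>) - (\<integral>x. f x \<partial>\<nu>) \<le> sqrt (2 * c * e)"
    proof (rule le_sqrt_of_quadratic_bound[OF c])
      fix l :: real assume l: "0 \<le> l"
      have mgf: "(\<integral>x. exp (l * g x) \<partial>\<nu>) \<le> exp (c * l\<^sup>2 / 2)"
        unfolding c_def \<theta>_def using gB
        by (intro mgf_le_of_transport_information[OF assms(1-6,8,9) _ g g_int l])
          (auto simp: bounded_iff)
      have lg: "\<bar>l * g x\<bar> \<le> l * (B + \<bar>\<integral>x. f x \<partial>\<nu>\<bar>)" for x
        using gB[of x] l by (simp add: abs_mult mult_left_mono)
      have "l * ((\<integral>x. f x \<partial>\<mu>) - (\<integral>x. f x \<partial>\<nu>)) = (\<integral>x. l * g x \<partial>\<mu>)"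
        by (simp add: g_int\<mu>)
      also have "\<dots> \<le> e + ln (\<integral>x. exp (l * g x) \<partial>\<nu>)"
        using entropy_variational[OF h'(1) _ h'(2) \<mu>(1)[unfolded h'(3)] h(2) lg]
        unfolding e_def h(3) h'(3)[symmetric] by simp
      also have "\<dots> \<le> e + c * l\<^sup>2 / 2"
      \<comment> \<open>Taking logarithms requires a positive integral;
        \<open>1 + u \<le> exp u\<close> and the centring of \<open>g\<close> even give a value of
        at least \<open>1\<close>.\<close>
      proof -
        have "integrable \<nu> (\<lambda>x. exp (l * g x))"
          using abs_le_D1[OF lg]
          by (intro integrable_bounded[where B="exp (l * (B + \<bar>\<integral>x. f x \<partial>\<nu>\<bar>))"]) simp_all
        moreover have int_g: "integrable \<nu> (\<lambda>x. 1 + l * g x)"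
          by (intro Bochner_Integration.integrable_add integrable_mult_right
              integrable_bounded[OF _ gB] integrable_const) measurable
        ultimately have "(\<integral>x. 1 + l * g x \<partial>\<nu>) \<le> (\<integral>x. exp (l * g x) \<partial>\<nu>)"
          by (intro integral_mono exp_ge_add_one_self)
        moreover have "(\<integral>x. 1 + l * g x \<partial>\<nu>) = 1"
        proof -
          have "integrable \<nu> g" by (rule integrable_bounded[OF _ gB]) measurable
          then show ?thesis by (simp add: g_int prob_space)
        qed
        ultimately have "1 \<le> (\<integral>x. exp (l * g x) \<partial>\<nu>)" by simp
        then have "ln (\<integral>x. exp (l * g x) \<partial>\<nu>) \<le> ln (exp (c * l\<^sup>2 / 2))"
          using mgf by (intro ln_mono) simp_all
        then show ?thesis by simp
      qed
      finally show "l * ((\<integral>x. f x \<partial>\<mu>) - (\<integral>x. f x \<partial>\<nu>)) \<le> e + c * l\<^sup>2 / 2" .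
    qed
  qed
  then show "W1 \<mu> \<nu> \<le> ennreal (sqrt (sqrt (2 * enn2real (Theta m \<nu>)) / K * real_of_ereal (Ent \<nu> \<mu>)))"
    by (simp only: c2 \<theta>_def e_def)
qed

end
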